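(* Assume that $\ell(\cdot,b):\mathbb{R}^s\to\mathbb{R}$ is $L_\ell$-smooth and convex and that each $r_i:\mathbb{R}^{d_i}\to\mathbb{R}$ ($i=1,\dots,n$) is $L_r$-smooth and convex. Let the sequence be generated by the algorithm EGVFL described in the context, from any starting point $(x^0,z^0,y^0)\in\mathbb{R}^{d+2s}$, with stepsize $$\gamma=\frac12\min\left\{1;\ \frac{1}{\sqrt{\lambda_{\max}(A^TA)}};\ \frac1{L_r};\ \frac1{L_\ell}\right\}.$$ Then there is an absolute constant $C>0$ such that for every $K\ge 1$ $$\mathrm{gap}(\bar x^K,\bar z^K,\bar y^K)\le C\,\frac{\left(1+\sqrt{\lambda_{\max}(A^TA)}+L_\ell+L_r\right)D^2}{K},$$ where $\bar x^K=\frac1K\sum_{k=0}^{K-1}x^{k+1/2}$, $\bar z^K=\frac1K\sum_{k=0}^{K-1}z^{k+1/2}$, $\bar y^K=\frac1K\sum_{k=0}^{K-1}y^{k+1/2}$ and $D^2=\max_{x\in\mathcal X,z\in\mathcal Z,y\in\mathcal Y}\left[\|x^0-x\|^2+\|z^0-z\|^2+\|y^0-y\|^2\right]$.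
   Context: Setting: $n,s,d_1,\dots,d_n$ are positive integers, $d=\sum_i d_i$, $A_i\in\mathbb{R}^{s\times d_i}$, $A=[A_1,\dots,A_n]\in\mathbb{R}^{s\times d}$, $b\in\mathbb{R}^s$ is fixed, and $x=(x_1,\dots,x_n)\in\mathbb{R}^d$ with $x_i\in\mathbb{R}^{d_i}$, so $Ax=\sum_iA_ix_i$. $\ell:\mathbb{R}^s\times\mathbb{R}^s\to\mathbb{R}$, and $\nabla\ell(z,b)$ is the gradient in the first argument. The saddle point problem is $\min_{(x,z)\in\mathbb{R}^{d+s}}\max_{y\in\mathbb{R}^s}L(x,z,y)$ with $$L(x,z,y)=\ell(z,b)+\sum_{i=1}^n r_i(x_i)+y^T\Big(\sum_{i=1}^nA_ix_i-z\Big).$$ $\mathcal X\subset\mathbb{R}^d$, $\mathcal Z\subset\mathbb{R}^s$, $\mathcal Y\subset\mathbb{R}^s$ are nonempty compact sets used only to define the convergence criterion $$\mathrm{gap}(x,z,y)=\max_{\tilde y\in\mathcal Y}L(x,z,\tilde y)-\min_{\tilde x\in\mathcal X,\tilde z\in\mathcal Z}L(\tilde x,\tilde z,y).$$ A function $f$ is $L$-smooth ($L>0$) if it is differentiable and $\|\nabla f(u)-\nabla f(v)\|\le L\|u-v\|$ for all $u,v$. Norms are Euclidean; $\lambda_{\max}$ is the largest eigenvalue; $1/0=+\infty$. Algorithm EGVFL: for $k=0,\dots,K-1$, $x_i^{k+1/2}=x_i^k-\gamma(A_i^Ty^k+\nabla r_i(x_i^k))$ for all $i$; $z^{k+1/2}=z^k-\gamma(\nabla\ell(z^k,b)-y^k)$;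 $y^{k+1/2}=y^k+\gamma(\sum_iA_ix_i^k-z^k)$; $x_i^{k+1}=x_i^k-\gamma(A_i^Ty^{k+1/2}+\nabla r_i(x_i^{k+1/2}))$ for all $i$; $z^{k+1}=z^k-\gamma(\nabla\ell(z^{k+1/2},b)-y^{k+1/2})$; $y^{k+1}=y^k+\gamma(\sum_iA_ix_i^{k+1/2}-z^{k+1/2})$. *)

theory Defs
  imports
    "HOL-Analysis.Abstract_Metric_Spaces"
    "HOL-Analysis.L2_Norm"
    "HOL-Library.Extended_Real"
    "Jordan_Normal_Form.Char_Poly"
begin

text \<open>The constant in the theorem is the same for all dimensions, so the dimensions are
  quantified inside the statement and cannot be types. Euclidean \<open>m\<close>-space is therefore
  \<open>carrier_vec m\<close>, and the analytic notions are relative to that carrier.\<close>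

definition vnorm :: "real vec \<Rightarrow> real" where
  "vnorm v = L2_set (\<lambda>i. v $ i) {..<dim_vec v}"

text \<open>\<open>vdist m u v\<close> is \<open>vnorm (u - v)\<close> on \<open>carrier_vec m\<close>. It is written out because the
  locale \<open>Metric_space\<close> requires symmetry also outside the carrier, where \<open>u - v\<close> has the
  dimension of \<open>v\<close>.\<close>
definition vdist :: "nat \<Rightarrow> real vec \<Rightarrow> real vec \<Rightarrow> real" where
  "vdist m u v = L2_set (\<lambda>i. u $ i - v $ i) {..<m}"

definition euclid_topology :: "nat \<Rightarrow> real vec topology" where
  "euclid_topology m = Metric_space.mtopology (carrier_vec m) (vdist m)"

lemma vdist_eq_vnorm:
  "u \<in> carrier_vec m \<Longrightarrow> v \<in> carrier_vec m \<Longrightarrow> vdist m u v = vnorm (u - v)"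
  by (auto simp: vnorm_def vdist_def intro!: L2_set_cong)

lemma Metric_space_vdist: "Metric_space (carrier_vec m) (vdist m)"
proof
  fix u v w :: "real vec"
  show "0 \<le> vdist m u v" by (simp add: vdist_def)
  show "vdist m u v = vdist m v u"
    by (simp add: vdist_def L2_set_def power2_commute)
  show "vdist m u v = 0 \<longleftrightarrow> u = v" if "u \<in> carrier_vec m" "v \<in> carrier_vec m"
    using that by (auto simp: vdist_def L2_set_eq_0_iff intro!: eq_vecI)
  show "vdist m u w \<le> vdist m u v + vdist m v w"
    using L2_set_triangle_ineq[of "\<lambda>i. u $ i - v $ i" "\<lambda>i. v $ i - w $ i" "{..<m}"]
    by (simp add: vdist_def)
qed

text \<open>\<open>g\<close> represents the Frechet derivative of \<open>f\<close> at \<open>u\<close>.\<close>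
definition has_gradient :: "nat \<Rightarrow> (real vec \<Rightarrow> real) \<Rightarrow> real vec \<Rightarrow> real vec \<Rightarrow> bool" where
  "has_gradient m f g u \<longleftrightarrow> g \<in> carrier_vec m \<and>
     (\<forall>e>0. \<exists>\<delta>>0. \<forall>v\<in>carrier_vec m. vnorm (v - u) < \<delta> \<longrightarrow>
        \<bar>f v - f u - g \<bullet> (v - u)\<bar> \<le> e * vnorm (v - u))"

lemma has_gradient_unique:
  assumes g: "has_gradient m f g u" and h: "has_gradient m f h u" and u: "u \<in> carrier_vec m"
  shows "g = h"
proof (rule ccontr)
  assume ne: "g \<noteq> h"
  have gc: "g \<in> carrier_vec m" and hc: "h \<in> carrier_vec m"
    using g h by (auto simp: has_gradient_def)
  define w where "w = g - h"
  define N where "N = vnorm w"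
  have wc: "w \<in> carrier_vec m" using gc hc by (simp add: w_def)
  have "N \<noteq> 0"
    using ne gc hc Metric_space.zero[OF Metric_space_vdist, of g m h]
    by (simp add: N_def w_def vdist_eq_vnorm)
  then have N: "0 < N" by (simp add: N_def vnorm_def order_less_le)
  have NN: "w \<bullet> w = N\<^sup>2"
    using wc by (simp add: N_def vnorm_def L2_set_def scalar_prod_def sum_nonneg
        power2_eq_square atLeast0LessThan)
  from g N obtain d1 where d1: "0 < d1" "\<And>v. v \<in> carrier_vec m \<Longrightarrow> vnorm (v - u) < d1 \<Longrightarrow>
      \<bar>f v - f u - g \<bullet> (v - u)\<bar> \<le> N / 4 * vnorm (v - u)"
    unfolding has_gradient_def by (meson divide_pos_pos zero_less_numeral)
  from h N obtain d2 where d2: "0 < d2" "\<And>v. v \<in> carrier_vec m \<Longrightarrow> vnorm (v - u) < d2 \<Longrightarrow>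
      \<bar>f v - f u - h \<bullet> (v - u)\<bar> \<le> N / 4 * vnorm (v - u)"
    unfolding has_gradient_def by (meson divide_pos_pos zero_less_numeral)
  define t where "t = min d1 d2 / (2 * N)"
  have t: "0 < t" using d1(1) d2(1) N by (simp add: t_def)
  define v where "v = u + t \<cdot>\<^sub>v w"
  have vc: "v \<in> carrier_vec m" using u wc by (simp add: v_def)
  have vu: "v - u = t \<cdot>\<^sub>v w" using u wc by (auto simp: v_def)
  have nv: "vnorm (v - u) = t * N"
    using t unfolding vu N_def vnorm_def by (auto simp: L2_set_right_distrib intro!: L2_set_cong)
  have "t * N = min d1 d2 / 2" using N by (simp add: t_def)
  then have small: "vnorm (v - u) < d1" "vnorm (v - u) < d2"
    using nv d1(1) d2(1) by linarith+
  have "w \<bullet> (v - u) = g \<bullet> (v - u) - h \<bullet> (v - u)"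
    unfolding w_def by (rule minus_scalar_prod_distrib) (use gc hc vc u in auto)
  then have "g \<bullet> (v - u) - h \<bullet> (v - u) = t * N\<^sup>2"
    using wc NN by (simp add: vu)
  moreover have "t * N\<^sup>2 > 0" using t N by simp
  moreover have "N / 4 * (t * N) = t * N\<^sup>2 / 4" by (simp add: power2_eq_square)
  ultimately show False
    using d1(2)[OF vc small(1)] d2(2)[OF vc small(2)] unfolding nv by linarith
qed

definition gradient :: "nat \<Rightarrow> (real vec \<Rightarrow> real) \<Rightarrow> real vec \<Rightarrow> real vec" where
  "gradient m f u = (THE g. has_gradient m f g u)"

definition smooth_vec :: "nat \<Rightarrow> real \<Rightarrow> (real vec \<Rightarrow> real) \<Rightarrow> bool" where
  "smooth_vec m L f \<longleftrightarrow> 0 < L \<and>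
     (\<forall>u\<in>carrier_vec m. \<exists>g. has_gradient m f g u) \<and>
     (\<forall>u\<in>carrier_vec m. \<forall>v\<in>carrier_vec m.
        vnorm (gradient m f u - gradient m f v) \<le> L * vnorm (u - v))"

definition convex_vec :: "nat \<Rightarrow> (real vec \<Rightarrow> real) \<Rightarrow> bool" where
  "convex_vec m f \<longleftrightarrow>
     (\<forall>u\<in>carrier_vec m. \<forall>v\<in>carrier_vec m. \<forall>t\<in>{0..1}.
        f ((1 - t) \<cdot>\<^sub>v u + t \<cdot>\<^sub>v v) \<le> (1 - t) * f u + t * f v)"

abbreviation vsum :: "nat \<Rightarrow> (nat \<Rightarrow> real vec) \<Rightarrow> nat \<Rightarrow> real vec" where
  "vsum m v N \<equiv> finsum_vec TYPE(real) m v {..<N}"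

definition vmean :: "nat \<Rightarrow> nat \<Rightarrow> (nat \<Rightarrow> real vec) \<Rightarrow> real vec" where
  "vmean m K v = (1 / real K) \<cdot>\<^sub>v vsum m v K"

text \<open>Blocks are numbered from \<open>0\<close>. A point of the product of the spaces of dimension \<open>d i\<close>
  for \<open>i < n\<close> is the concatenated vector of length \<open>\<Sum>i<n. d i\<close>, and \<open>block d i\<close> extracts
  its \<open>i\<close>-th component.\<close>
definition block :: "(nat \<Rightarrow> nat) \<Rightarrow> nat \<Rightarrow> real vec \<Rightarrow> real vec" where
  "block d i x = vec (d i) (\<lambda>j. x $ ((\<Sum>k<i. d k) + j))"

definition hconcat :: "nat \<Rightarrow> nat \<Rightarrow> (nat \<Rightarrow> real mat) \<Rightarrow> real mat" where
  "hconcat n s A = mat_of_cols s (concat (map (\<lambda>i. cols (A i)) [0..<n]))"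

text \<open>Meaningful for matrices that have a real eigenvalue; used for Gram matrices only.\<close>
definition lambda_max :: "real mat \<Rightarrow> real" where
  "lambda_max M = Max {k. eigenvalue M k}"

definition lagrangian ::
  "nat \<Rightarrow> nat \<Rightarrow> (nat \<Rightarrow> nat) \<Rightarrow> (nat \<Rightarrow> real mat) \<Rightarrow> (real vec \<Rightarrow> real vec \<Rightarrow> real) \<Rightarrow> real vec \<Rightarrow>
   (nat \<Rightarrow> real vec \<Rightarrow> real) \<Rightarrow> real vec \<Rightarrow> real vec \<Rightarrow> real vec \<Rightarrow> real" where
  "lagrangian n s d A ell b r x z y =
     ell z b + (\<Sum>i<n. r i (block d i x)) +
     y \<bullet> (vsum s (\<lambda>i. A i *\<^sub>v block d i x) n - z)"

text \<open>On nonempty compact sets and for continuous data the suprema and infima below are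
  attained, i.e. they are maxima and minima.\<close>
definition gap ::
  "nat \<Rightarrow> nat \<Rightarrow> (nat \<Rightarrow> nat) \<Rightarrow> (nat \<Rightarrow> real mat) \<Rightarrow> (real vec \<Rightarrow> real vec \<Rightarrow> real) \<Rightarrow> real vec \<Rightarrow>
   (nat \<Rightarrow> real vec \<Rightarrow> real) \<Rightarrow> real vec set \<Rightarrow> real vec set \<Rightarrow> real vec set \<Rightarrow>
   real vec \<Rightarrow> real vec \<Rightarrow> real vec \<Rightarrow> real" where
  "gap n s d A ell b r X Z Y x z y =
     (SUP y'\<in>Y. lagrangian n s d A ell b r x z y') -
     (INF (x', z')\<in>X \<times> Z. lagrangian n s d A ell b r x' z' y)"

definition diam_sq ::
  "real vec set \<Rightarrow> real vec set \<Rightarrow> real vec set \<Rightarrow> real vec \<Rightarrow> real vec \<Rightarrow> real vec \<Rightarrow> real" where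
  "diam_sq X Z Y x0 z0 y0 =
     (SUP (x, z, y)\<in>X \<times> Z \<times> Y.
        (vnorm (x0 - x))\<^sup>2 + (vnorm (z0 - z))\<^sup>2 + (vnorm (y0 - y))\<^sup>2)"

text \<open>The sequences \<open>x, z, y\<close> are the iterates and \<open>xh, zh, yh\<close> the half-step iterates
  (\<open>xh k\<close> has index \<open>k + 1/2\<close>) of the first \<open>K\<close> steps.\<close>
definition egvfl ::
  "nat \<Rightarrow> nat \<Rightarrow> (nat \<Rightarrow> nat) \<Rightarrow> (nat \<Rightarrow> real mat) \<Rightarrow> (real vec \<Rightarrow> real vec \<Rightarrow> real) \<Rightarrow> real vec \<Rightarrow>
   (nat \<Rightarrow> real vec \<Rightarrow> real) \<Rightarrow> real \<Rightarrow> nat \<Rightarrow>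
   (nat \<Rightarrow> real vec) \<Rightarrow> (nat \<Rightarrow> real vec) \<Rightarrow> (nat \<Rightarrow> real vec) \<Rightarrow>
   (nat \<Rightarrow> real vec) \<Rightarrow> (nat \<Rightarrow> real vec) \<Rightarrow> (nat \<Rightarrow> real vec) \<Rightarrow> bool" where
  "egvfl n s d A ell b r \<gamma> K x z y xh zh yh \<longleftrightarrow>
     (\<forall>k\<le>K. x k \<in> carrier_vec (\<Sum>i<n. d i) \<and> z k \<in> carrier_vec s \<and> y k \<in> carrier_vec s) \<and>
     (\<forall>k<K. xh k \<in> carrier_vec (\<Sum>i<n. d i) \<and> zh k \<in> carrier_vec s \<and> yh k \<in> carrier_vec s) \<and>
     (\<forall>k<K.
       (\<forall>i<n. block d i (xh k) = block d i (x k) -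
          \<gamma> \<cdot>\<^sub>v (transpose_mat (A i) *\<^sub>v y k + gradient (d i) (r i) (block d i (x k)))) \<and>
       zh k = z k - \<gamma> \<cdot>\<^sub>v (gradient s (\<lambda>w. ell w b) (z k) - y k) \<and>
       yh k = y k + \<gamma> \<cdot>\<^sub>v (vsum s (\<lambda>i. A i *\<^sub>v block d i (x k)) n - z k) \<and>
       (\<forall>i<n. block d i (x (Suc k)) = block d i (x k) -
          \<gamma> \<cdot>\<^sub>v (transpose_mat (A i) *\<^sub>v yh k + gradient (d i) (r i) (block d i (xh k)))) \<and>
       z (Suc k) = z k - \<gamma> \<cdot>\<^sub>v (gradient s (\<lambda>w. ell w b) (zh k) - yh k) \<and>
       y (Suc k) = y k + \<gamma> \<cdot>\<^sub>v (vsum s (\<lambda>i. A i *\<^sub>v block d i (xh k)) n - zh k))"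

end

theory Submission
  imports Defs
begin

text \<open>One step of the extragradient method satisfies the exact identity
  \<open>2\<gamma> \<langle>F(u\<^sub>h), u\<^sub>h - w\<rangle> = \<parallel>u - w\<parallel>\<^sup>2 - \<parallel>u\<^sub>+ - w\<parallel>\<^sup>2 - \<parallel>u\<^sub>h - u\<parallel>\<^sup>2 + \<gamma>\<^sup>2 \<parallel>F(u\<^sub>h) - F(u)\<parallel>\<^sup>2\<close>, where
  \<open>F(x, z, y) = (A\<^sup>T y + \<nabla>r(x), \<nabla>\<ell>(z) - y, z - A x)\<close>. Each component of \<open>F(u\<^sub>h) - F(u)\<close> is a sum of two
  terms whose Lipschitz constants are at most \<open>1 / (2\<gamma>)\<close>, and each of the three displacements
  enters exactly two components, so the last two terms of the identity add up to something
  nonpositive. By convexity \<open>\<langle>F(u\<^sub>h), u\<^sub>h - w\<rangle>\<close> dominates the gap at \<open>w\<close>; telescoping and Jensen's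
  inequality give a gap of at most \<open>D\<^sup>2 / (2\<gamma>K)\<close>, and \<open>1 / (2\<gamma>)\<close> is a maximum bounded by the sum
  \<open>1 + \<surd>\<lambda>\<^sub>m\<^sub>a\<^sub>x + L\<^sub>\<ell> + L\<^sub>r\<close>. Hence \<open>C = 1\<close> works.\<close>

unbundle no inner_syntax
no_notation Finite_Cartesian_Product.vec_nth (infixl "$" 90)

subsection \<open>Norms and the largest eigenvalue of a Gram matrix\<close>

lemma vnorm_power2: "(vnorm v)\<^sup>2 = v \<bullet> v"
  by (simp add: vnorm_def L2_set_def scalar_prod_def sum_nonneg power2_eq_square atLeast0LessThan)

lemma scalar_prod_self_nonneg: "0 \<le> v \<bullet> (v :: real vec)"
  by (metis vnorm_power2 zero_le_power2)

lemma vnorm_nonneg: "0 \<le> vnorm v"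
  by (simp add: vnorm_def)

lemma vnorm_smult: "vnorm (c \<cdot>\<^sub>v v) = \<bar>c\<bar> * vnorm v"
  by (rule power2_eq_imp_eq) (auto simp: vnorm_power2 power_mult_distrib power2_eq_square[of c] vnorm_nonneg)

lemma vnorm_le_iff:
  "0 \<le> c \<Longrightarrow> vnorm u \<le> c * vnorm v \<longleftrightarrow> u \<bullet> u \<le> c\<^sup>2 * (v \<bullet> v)"
  by (metis abs_le_square_iff abs_of_nonneg mult_nonneg_nonneg power_mult_distrib vnorm_nonneg
      vnorm_power2)

lemma scalar_prod_le_vnorm:
  assumes "u \<in> carrier_vec m" "v \<in> carrier_vec m"
  shows "\<bar>u \<bullet> v\<bar> \<le> vnorm u * vnorm v"
proof -
  have "\<bar>u \<bullet> v\<bar> \<le> (\<Sum>i<m. \<bar>u $ i\<bar> * \<bar>v $ i\<bar>)"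
    using assms by (auto simp: scalar_prod_def atLeast0LessThan abs_mult intro: sum_abs[THEN order_trans])
  also have "\<dots> \<le> L2_set (\<lambda>i. u $ i) {..<m} * L2_set (\<lambda>i. v $ i) {..<m}"
    by (rule L2_set_mult_ineq)
  finally show ?thesis using assms by (simp add: vnorm_def)
qed

lemma scalar_prod_diff_self:
  fixes u v :: "real vec"
  assumes "u \<in> carrier_vec m" "v \<in> carrier_vec m"
  shows "(u - v) \<bullet> (u - v) = u \<bullet> u - 2 * (u \<bullet> v) + v \<bullet> v"
  using assms comm_scalar_prod[of v m u]
  by (simp add: minus_scalar_prod_distrib[of _ m] scalar_prod_minus_distrib[of _ m])

text \<open>Cauchy-Schwarz in each row gives the squared Frobenius norm as a constant. The added 1
  keeps the constant positive even for a zero matrix, so that one may divide by it.\<close>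

lemma mult_mat_vec_le:
  fixes M :: "real mat"
  assumes M: "M \<in> carrier_mat p q"
  obtains c where "0 < c" "\<And>v. v \<in> carrier_vec q \<Longrightarrow> (M *\<^sub>v v) \<bullet> (M *\<^sub>v v) \<le> c * (v \<bullet> v)"
proof
  show "0 < 1 + (\<Sum>i<p. row M i \<bullet> row M i)"
    by (intro add_pos_nonneg sum_nonneg scalar_prod_self_nonneg) auto
  fix v :: "real vec" assume v: "v \<in> carrier_vec q"
  have "(M *\<^sub>v v) \<bullet> (M *\<^sub>v v) = (\<Sum>i<p. (row M i \<bullet> v)\<^sup>2)"
    using M by (simp add: scalar_prod_def[of "M *\<^sub>v v"] atLeast0LessThan power2_eq_square)
  also have "\<dots> \<le> (\<Sum>i<p. (row M i \<bullet> row M i) * (v \<bullet> v))"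
  proof (rule sum_mono)
    fix i assume "i \<in> {..<p}"
    then have "\<bar>row M i \<bullet> v\<bar> \<le> \<bar>vnorm (row M i) * vnorm v\<bar>"
      using scalar_prod_le_vnorm[of "row M i" q v] M v by (simp add: vnorm_nonneg)
    then show "(row M i \<bullet> v)\<^sup>2 \<le> (row M i \<bullet> row M i) * (v \<bullet> v)"
      by (simp add: abs_le_square_iff power_mult_distrib vnorm_power2)
  qed
  also have "\<dots> \<le> (1 + (\<Sum>i<p. row M i \<bullet> row M i)) * (v \<bullet> v)"
    by (simp add: sum_distrib_right[symmetric] distrib_right scalar_prod_self_nonneg)
  finally show "(M *\<^sub>v v) \<bullet> (M *\<^sub>v v) \<le> (1 + (\<Sum>i<p. row M i \<bullet> row M i)) * (v \<bullet> v)" .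
qed

section \<open>Rayleigh quotients of Gram matrices and operator norm bounds\<close>

lemma scalar_prod_gram:
  fixes M :: "real mat"
  assumes "M \<in> carrier_mat p q" "u \<in> carrier_vec q" "v \<in> carrier_vec q"
  shows "u \<bullet> ((M\<^sup>T * M) *\<^sub>v v) = (M *\<^sub>v u) \<bullet> (M *\<^sub>v v)"
proof -
  have "u \<bullet> ((M\<^sup>T * M) *\<^sub>v v) = u \<bullet> (M\<^sup>T *\<^sub>v (M *\<^sub>v v))"
    using assms by (simp add: assoc_mult_mat_vec[of _ q p _ q])
  also have "\<dots> = (M\<^sup>T *\<^sub>v (M *\<^sub>v v)) \<bullet> u"
    using assms by (intro comm_scalar_prod[of _ q]) auto
  also have "\<dots> = (M *\<^sub>v v) \<bullet> (M *\<^sub>v u)"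
    using assms by (intro transpose_vec_mult_scalar) auto
  also have "\<dots> = (M *\<^sub>v u) \<bullet> (M *\<^sub>v v)"
    using assms by (intro comm_scalar_prod[of _ p]) auto
  finally show ?thesis .
qed

text \<open>No compactness is needed: if the supremum \<open>\<mu>\<close> of the Rayleigh quotient were not an
  eigenvalue, \<open>\<mu> I - M\<^sup>T M\<close> would be invertible and positive semidefinite, hence bounded below
  by a positive multiple of the identity, and \<open>\<mu>\<close> could be lowered.\<close>
lemma gram_sup_eigenvalue:
  fixes M :: "real mat"
  assumes M: "M \<in> carrier_mat p q" and q: "0 < q"
  obtains \<mu> where "eigenvalue (M\<^sup>T * M) \<mu>"
    "\<And>v. v \<in> carrier_vec q \<Longrightarrow> (M *\<^sub>v v) \<bullet> (M *\<^sub>v v) \<le> \<mu> * (v \<bullet> v)"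
proof -
  define S where "S = {v \<in> carrier_vec q. v \<bullet> v = (1::real)}"
  define Q where "Q v = (M *\<^sub>v v) \<bullet> (M *\<^sub>v v)" for v
  define \<mu> where "\<mu> = (SUP v\<in>S. Q v)"
  define G where "G = M\<^sup>T * M"
  have G: "G \<in> carrier_mat q q" using M by (simp add: G_def)
  obtain c where "\<And>v. v \<in> carrier_vec q \<Longrightarrow> Q v \<le> c * (v \<bullet> v)"
    using mult_mat_vec_le[OF M] unfolding Q_def by blast
  then have "\<And>v. v \<in> S \<Longrightarrow> Q v \<le> c" unfolding S_def by fastforce
  then have bdd: "bdd_above (Q ` S)" by (auto simp: bdd_above_def)
  have "unit_vec q 0 \<in> S" using q by (simp add: S_def)
  then have S: "S \<noteq> {}" by auto
  have Q0: "0 \<le> Q v" for v unfolding Q_def by (rule scalar_prod_self_nonneg)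
  have le1: "Q v \<le> \<mu>" if "v \<in> S" for v
    unfolding \<mu>_def using that bdd by (rule cSUP_upper)
  have mu0: "0 \<le> \<mu>" using le1 Q0 S by (meson all_not_in_conv order_trans)
  \<comment> \<open>Both sides are homogeneous of degree 2, so a bound on the unit sphere extends to
    all vectors; the zero vector, which cannot be normalised, is treated apart.\<close>
  have scale: "Q v \<le> k * (v \<bullet> v)" if k: "\<And>v. v \<in> S \<Longrightarrow> Q v \<le> k" and v: "v \<in> carrier_vec q" for k v
  proof (cases "v \<bullet> v = 0")
    case True
    then have "vnorm v = 0" using vnorm_power2[of v] by simp
    then have "v = 0\<^sub>v q"
      using v by (auto simp: vnorm_def L2_set_eq_0_iff intro!: eq_vecI)
    moreover have "M *\<^sub>v 0\<^sub>v q = 0\<^sub>v p" using M by auto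
    ultimately show ?thesis by (simp add: Q_def)
  next
    case False
    define N where "N = vnorm v"
    have N: "N > 0" "N\<^sup>2 = v \<bullet> v"
      using False vnorm_power2[of v] vnorm_nonneg[of v] by (auto simp: N_def order_less_le)
    let ?u = "(1 / N) \<cdot>\<^sub>v v"
    have "?u \<in> S"
      using v N by (simp add: S_def power2_eq_square[symmetric] flip: N(2))
    from k[OF this] have "Q ?u \<le> k" .
    moreover have "Q ?u = Q v / N\<^sup>2"
      using v M by (simp add: Q_def mult_mat_vec[of _ p q] power2_eq_square)
    moreover have "0 < N\<^sup>2" using N(1) by simp
    ultimately show ?thesis by (simp add: divide_le_eq N(2) [symmetric])
  qed
  have le: "Q v \<le> \<mu> * (v \<bullet> v)" if "v \<in> carrier_vec q" for v
    using scale[OF le1 that] .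
  have "eigenvalue G \<mu>"
  proof (rule ccontr)
    assume "\<not> eigenvalue G \<mu>"
    define B where "B = char_matrix G \<mu>"
    have B: "B \<in> carrier_mat q q" using G by (simp add: B_def)
    have "det B \<noteq> 0" using \<open>\<not> eigenvalue G \<mu>\<close> eigenvalue_det[OF G] by (simp add: B_def)
    from det_non_zero_imp_unit[OF B this, unfolded Units_def, of "()"]
    obtain C where C: "C \<in> carrier_mat q q" and CB: "C * B = 1\<^sub>m q"
      by (auto simp: ring_mat_def)
    obtain c where c: "c > 0" "\<And>v. v \<in> carrier_vec q \<Longrightarrow> (C *\<^sub>v v) \<bullet> (C *\<^sub>v v) \<le> c * (v \<bullet> v)"
      using mult_mat_vec_le[OF C] by blast
    have Bv: "B *\<^sub>v v = G *\<^sub>v v - \<mu> \<cdot>\<^sub>v v" if "v \<in> carrier_vec q" for v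
      using that G unfolding B_def char_matrix_def
      by (intro eq_vecI) (auto simp: add_mult_distrib_mat_vec[of _ q q] scalar_prod_def sum.distrib algebra_simps
         sum_subtractf sum_distrib_left if_distrib if_distribR sum.delta cong: if_cong)
    \<comment> \<open>\<open>t\<close> is the length of a step from \<open>v\<close> along
      \<open>w = (G - \<mu> I) v\<close>. Since \<open>t * \<mu> \<le> 1\<close>, the quadratic term
      \<open>\<mu> * t^2 * N\<close> uses up at most half of the linear gain
      \<open>2 * t * N\<close>.\<close>
    define t where "t = 1 / (\<mu> + 1)"
    have t: "t > 0" "t * \<mu> \<le> 1" using mu0 by (auto simp: t_def)
    have "Q v \<le> \<mu> - t / c" if v: "v \<in> S" for v
    proof -
      have vc: "v \<in> carrier_vec q" and vv: "v \<bullet> v = 1" using v by (auto simp: S_def)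
      define w where "w = B *\<^sub>v v"
      define N where "N = w \<bullet> w"
      have wc: "w \<in> carrier_vec q" using B vc by (simp add: w_def)
      \<comment> \<open>\<open>C\<close> recovers the unit vector \<open>v\<close> from
        \<open>w\<close>, so the length of \<open>w\<close> is bounded below uniformly in
        \<open>v\<close>.\<close>
      have "C *\<^sub>v w = v"
        using B C CB vc by (simp add: w_def flip: assoc_mult_mat_vec[of _ q q _ q])
      then have N: "1 \<le> c * N" using c(2)[OF wc] vv by (simp add: N_def)
      have "N = w \<bullet> (G *\<^sub>v v) - \<mu> * (w \<bullet> v)"
        using G wc vc unfolding N_def by (subst (2) w_def) (simp add: Bv scalar_prod_minus_distrib[of _ q])
      then have NQ: "(M *\<^sub>v w) \<bullet> (M *\<^sub>v v) - \<mu> * (w \<bullet> v) = N"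
        using scalar_prod_gram[OF M wc vc] by (simp add: G_def)
      \<comment> \<open>The bound by \<mu> is tested at \<open>v + t w\<close>, written as a
        difference to fit \<open>scalar_prod_diff_self\<close>. By \<open>NQ\<close> the first-order
        terms of the two sides differ by exactly \<open>2 * t * N\<close>, and this improves the
        bound for \<open>Q v\<close> itself.\<close>
      have "Q (v - (- t) \<cdot>\<^sub>v w) \<le> \<mu> * ((v - (- t) \<cdot>\<^sub>v w) \<bullet> (v - (- t) \<cdot>\<^sub>v w))"
        using vc wc by (intro le) auto
      moreover have "Q (v - (- t) \<cdot>\<^sub>v w) = Q v + 2 * t * ((M *\<^sub>v w) \<bullet> (M *\<^sub>v v)) + t\<^sup>2 * Q w"
        using M vc wc comm_scalar_prod[of "M *\<^sub>v v" p "M *\<^sub>v w"]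
        by (simp add: Q_def mult_minus_distrib_mat_vec[of _ p q] mult_mat_vec[of _ p q]
            scalar_prod_diff_self[of _ p] power2_eq_square)
      moreover have "(v - (- t) \<cdot>\<^sub>v w) \<bullet> (v - (- t) \<cdot>\<^sub>v w) = v \<bullet> v + 2 * t * (w \<bullet> v) + t\<^sup>2 * N"
        using vc wc comm_scalar_prod[of v q w]
        by (simp add: scalar_prod_diff_self[of _ q] power2_eq_square N_def)
      ultimately have "Q v + 2 * t * ((M *\<^sub>v w) \<bullet> (M *\<^sub>v v)) + t\<^sup>2 * Q w
          \<le> \<mu> * (1 + 2 * t * (w \<bullet> v) + t\<^sup>2 * N)" by (simp add: vv)
      then have "Q v + 2 * t * N + t\<^sup>2 * Q w \<le> \<mu> + \<mu> * t\<^sup>2 * N"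
        unfolding NQ[symmetric] by (simp add: algebra_simps)
      moreover have "t\<^sup>2 * Q w \<ge> 0" using Q0 by simp
      moreover have "\<mu> * t\<^sup>2 * N \<le> t * N"
        using mult_right_mono[OF t(2), of "t * N"] t(1) scalar_prod_self_nonneg[of w]
        by (simp add: N_def power2_eq_square ac_simps)
      ultimately have "Q v \<le> \<mu> - t * N" by linarith
      moreover have "t / c \<le> t * N"
        using N t(1) c(1) by (simp add: divide_le_eq ac_simps mult_le_cancel_left1)
      ultimately show ?thesis by linarith
    qed
    then have "\<mu> \<le> \<mu> - t / c"
      unfolding \<mu>_def using S by (intro cSUP_least) auto
    then show False using t(1) c(1) by (simp add: divide_le_0_iff)
  qed
  then show thesis using le that unfolding G_def Q_def by blast
qed

text \<open>The eigenvalues are the roots of a monic characteristic polynomial, hence finite in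
  number, so their \<open>Max\<close> dominates the eigenvalue \<mu> that bounds the Rayleigh
  quotient. Testing \<mu> at a unit vector shows that it is nonnegative.\<close>

lemma gram_le_lambda_max:
  fixes M :: "real mat"
  assumes M: "M \<in> carrier_mat p q" and q: "0 < q"
  shows "0 \<le> lambda_max (M\<^sup>T * M)"
    and "v \<in> carrier_vec q \<Longrightarrow> (M *\<^sub>v v) \<bullet> (M *\<^sub>v v) \<le> lambda_max (M\<^sup>T * M) * (v \<bullet> v)"
proof -
  obtain \<mu> where \<mu>: "eigenvalue (M\<^sup>T * M) \<mu>"
    "\<And>v. v \<in> carrier_vec q \<Longrightarrow> (M *\<^sub>v v) \<bullet> (M *\<^sub>v v) \<le> \<mu> * (v \<bullet> v)"
    using gram_sup_eigenvalue[OF M q] by blast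
  have G: "M\<^sup>T * M \<in> carrier_mat q q" using M by simp
  have "finite {k. eigenvalue (M\<^sup>T * M) k}"
    unfolding eigenvalue_root_char_poly[OF G]
    by (rule poly_roots_finite) (use degree_monic_char_poly[OF G] in auto)
  then have le: "\<mu> \<le> lambda_max (M\<^sup>T * M)"
    unfolding lambda_max_def using \<mu>(1) by (intro Max_ge) auto
  have "0 \<le> \<mu>"
    using \<mu>(2)[of "unit_vec q 0"] scalar_prod_self_nonneg[of "M *\<^sub>v unit_vec q 0"] q by simp
  then show "0 \<le> lambda_max (M\<^sup>T * M)" using le by simp
  show "(M *\<^sub>v v) \<bullet> (M *\<^sub>v v) \<le> lambda_max (M\<^sup>T * M) * (v \<bullet> v)" if "v \<in> carrier_vec q"
    using \<mu>(2)[OF that] mult_right_mono[OF le scalar_prod_self_nonneg[of v]] by linarith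
qed

text \<open>The bound for \<open>M\<close> is the square root of the Rayleigh bound. It passes to
  the transpose by duality: for \<open>u = M^T w\<close>, the square of the norm of \<open>u\<close>
  is the product of \<open>w\<close> with \<open>M u\<close>, hence at most \<sigma> times the norms
  of \<open>w\<close> and \<open>u\<close>, and one factor cancels.\<close>

lemma
  fixes M :: "real mat"
  assumes M: "M \<in> carrier_mat p q" and q: "0 < q"
  defines "\<sigma> \<equiv> sqrt (lambda_max (M\<^sup>T * M))"
  shows vnorm_mult_mat_le: "v \<in> carrier_vec q \<Longrightarrow> vnorm (M *\<^sub>v v) \<le> \<sigma> * vnorm v"
    and vnorm_mult_transpose_mat_le: "w \<in> carrier_vec p \<Longrightarrow> vnorm (M\<^sup>T *\<^sub>v w) \<le> \<sigma> * vnorm w"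
proof -
  have \<sigma>: "0 \<le> \<sigma>" "\<sigma>\<^sup>2 = lambda_max (M\<^sup>T * M)"
    using gram_le_lambda_max(1)[OF M q] by (auto simp: \<sigma>_def)
  show le: "vnorm (M *\<^sub>v v) \<le> \<sigma> * vnorm v" if "v \<in> carrier_vec q" for v
    using gram_le_lambda_max(2)[OF M q that] \<sigma> by (simp add: vnorm_le_iff)
  show "vnorm (M\<^sup>T *\<^sub>v w) \<le> \<sigma> * vnorm w" if w: "w \<in> carrier_vec p"
  proof -
    define u where "u = M\<^sup>T *\<^sub>v w"
    have u: "u \<in> carrier_vec q" using M w by (simp add: u_def)
    have "(vnorm u)\<^sup>2 = w \<bullet> (M *\<^sub>v u)"
      using transpose_vec_mult_scalar[OF M u w] by (simp add: vnorm_power2 u_def)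
    also have "\<dots> \<le> vnorm w * vnorm (M *\<^sub>v u)"
      using scalar_prod_le_vnorm[OF w mult_mat_vec_carrier[OF M u]] by simp
    also have "\<dots> \<le> vnorm w * (\<sigma> * vnorm u)"
      by (intro mult_left_mono le u vnorm_nonneg)
    finally have "vnorm u * vnorm u \<le> (\<sigma> * vnorm w) * vnorm u"
      by (simp add: power2_eq_square ac_simps)
    then show ?thesis
      using vnorm_nonneg[of u] vnorm_nonneg[of w] \<sigma>(1) unfolding u_def[symmetric]
      by (cases "vnorm u = 0") (auto simp: mult_le_cancel_right)
  qed
qed

subsection \<open>The extragradient method for a bilinearly coupled saddle point problem\<close>

lemma vnorm_add_le:
  assumes "u \<in> carrier_vec m" "v \<in> carrier_vec m"
  shows "vnorm (u + v) \<le> vnorm u + vnorm v"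
proof -
  have "vnorm (u + v) = L2_set (\<lambda>i. u $ i + v $ i) {..<m}"
    using assms by (auto simp: vnorm_def intro!: L2_set_cong)
  then show ?thesis
    using assms L2_set_triangle_ineq[of "\<lambda>i. u $ i" "\<lambda>i. v $ i" "{..<m}"] by (simp add: vnorm_def)
qed

lemma vnorm_diff_le:
  assumes "u \<in> carrier_vec m" "v \<in> carrier_vec m"
  shows "vnorm (u - v) \<le> vnorm u + vnorm v"
proof -
  have "u - v = u + (- 1) \<cdot>\<^sub>v v" using assms by auto
  then show ?thesis
    using vnorm_add_le[of u m "(- 1) \<cdot>\<^sub>v v"] assms by (simp add: vnorm_smult)
qed

section \<open>Gradients of smooth functions and the tangent inequality\<close>

lemma has_gradient_gradient:
  assumes "smooth_vec m L f" "u \<in> carrier_vec m"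
  shows "has_gradient m f (gradient m f u) u"
proof -
  obtain g where g: "has_gradient m f g u" using assms unfolding smooth_vec_def by blast
  then show ?thesis
    unfolding gradient_def using has_gradient_unique[OF _ g assms(2)] by (rule theI)
qed

lemma gradient_carrier:
  "smooth_vec m L f \<Longrightarrow> u \<in> carrier_vec m \<Longrightarrow> gradient m f u \<in> carrier_vec m"
  using has_gradient_gradient unfolding has_gradient_def by blast

text \<open>At a point \<open>w\<close> that lies a small fraction \<open>t\<close> of the way from
  \<open>u\<close> to \<open>v\<close>, convexity bounds \<open>f w - f u\<close> above by
  \<open>t * (f v - f u)\<close>, while differentiability bounds it below by
  \<open>t * (g \<bullet> (v - u) - e)\<close>. Dividing by \<open>t\<close> leaves an arbitrarily
  small error \<open>e\<close>.\<close>

lemma convex_vec_above_tangent: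
  assumes f: "convex_vec m f" and g: "has_gradient m f g u"
    and u: "u \<in> carrier_vec m" and v: "v \<in> carrier_vec m"
  shows "f u + g \<bullet> (v - u) \<le> f v"
proof -
  define N where "N = vnorm (v - u)"
  have N: "0 \<le> N" by (simp add: N_def vnorm_nonneg)
  have gc: "g \<in> carrier_vec m" using g by (simp add: has_gradient_def)
  have "f u + g \<bullet> (v - u) \<le> f v + e" if e: "0 < e" for e
  proof -
    \<comment> \<open>Dividing by \<open>N + 1\<close> instead of \<open>N\<close> covers the case
      \<open>v = u\<close>; the error at distance \<open>t * N\<close> is then still at most
      \<open>t * e\<close>.\<close>
    have "0 < e / (N + 1)" using e N by simp
    with g obtain \<delta> where \<delta>: "0 < \<delta>" "\<And>v. v \<in> carrier_vec m \<Longrightarrow> vnorm (v - u) < \<delta> \<Longrightarrow>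
        \<bar>f v - f u - g \<bullet> (v - u)\<bar> \<le> e / (N + 1) * vnorm (v - u)"
      unfolding has_gradient_def by meson
    \<comment> \<open>The first argument of the minimum makes \<open>w\<close> a convex combination,
      the second puts it into the ball of radius \<delta>.\<close>
    define t where "t = min 1 (\<delta> / (N + 1))"
    have t: "0 < t" "t \<le> 1" "t \<le> \<delta> / (N + 1)" using \<delta>(1) N by (auto simp: t_def)
    have tN: "t * N < \<delta>"
    proof -
      have "t * N < t * (N + 1)" using t(1) by simp
      also have "\<dots> \<le> \<delta>" using t(3) N by (simp add: le_divide_eq)
      finally show ?thesis .
    qed
    define w where "w = (1 - t) \<cdot>\<^sub>v u + t \<cdot>\<^sub>v v"
    have wc: "w \<in> carrier_vec m" using u v by (simp add: w_def)
    have wu: "w - u = t \<cdot>\<^sub>v (v - u)" using u v by (auto simp: w_def algebra_simps)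
    have nw: "vnorm (w - u) = t * N" using t(1) by (simp add: wu vnorm_smult N_def)
    have "\<bar>f w - f u - g \<bullet> (w - u)\<bar> \<le> e / (N + 1) * (t * N)"
      using \<delta>(2)[OF wc] tN by (simp add: nw)
    also have "\<dots> \<le> t * e"
      using e N t(1) by (simp add: divide_le_eq)
    finally have "f u + t * (g \<bullet> (v - u)) \<le> f w + t * e"
      using gc u v by (simp add: wu)
    also have "f w \<le> (1 - t) * f u + t * f v"
      using f u v t unfolding convex_vec_def w_def by auto
    finally have "t * (f u + g \<bullet> (v - u)) \<le> t * (f v + e)" by (simp add: algebra_simps)
    then show ?thesis using t(1) by simp
  qed
  then show ?thesis by (rule field_le_epsilon)
qed

section \<open>Finite sums, averages and Jensen's inequality\<close>

lemma vsum_carrier: "(\<And>k. k < K \<Longrightarrow> v k \<in> carrier_vec m) \<Longrightarrow> vsum m v K \<in> carrier_vec m"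
  by (rule finsum_vec_closed) auto

lemma vmean_carrier: "(\<And>k. k < K \<Longrightarrow> v k \<in> carrier_vec m) \<Longrightarrow> vmean m K v \<in> carrier_vec m"
  by (simp add: vmean_def vsum_carrier)

lemma scalar_prod_vsum:
  fixes w :: "real vec"
  assumes "w \<in> carrier_vec m" "\<And>k. k < K \<Longrightarrow> v k \<in> carrier_vec m"
  shows "w \<bullet> vsum m v K = (\<Sum>k<K. w \<bullet> v k)"
proof -
  have dim: "dim_vec (v k) = m" if "k < K" for k using assms(2)[OF that] by simp
  have "w \<bullet> vsum m v K = (\<Sum>i<m. \<Sum>k<K. w $ i * v k $ i)"
    using assms vsum_carrier[of K v m]
    by (auto simp: scalar_prod_def atLeast0LessThan index_finsum_vec sum_distrib_left intro!: sum.cong)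
  also have "\<dots> = (\<Sum>k<K. \<Sum>i<m. w $ i * v k $ i)"
    by (rule sum.swap)
  finally show ?thesis by (simp add: scalar_prod_def[of w "v _"] atLeast0LessThan dim)
qed

lemma sum_scalar_prod_vmean:
  fixes w :: "real vec"
  assumes "w \<in> carrier_vec m" "\<And>k. k < K \<Longrightarrow> v k \<in> carrier_vec m" "0 < K"
  shows "(\<Sum>k<K. w \<bullet> v k) = real K * (w \<bullet> vmean m K v)"
  using assms vsum_carrier[of K v m] by (simp add: vmean_def scalar_prod_vsum)

text \<open>The tangent inequality at the mean is summed over all points. The displacements from the
  mean add up to zero, so the linear terms cancel.\<close>

lemma jensen_vmean:
  fixes f :: "real vec \<Rightarrow> real"
  assumes tangent: "\<And>u v. u \<in> carrier_vec m \<Longrightarrow> v \<in> carrier_vec m \<Longrightarrow> f u + g u \<bullet> (v - u) \<le> f v"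
    and g: "\<And>u. u \<in> carrier_vec m \<Longrightarrow> g u \<in> carrier_vec m"
    and v: "\<And>k. k < K \<Longrightarrow> v k \<in> carrier_vec m" and K: "0 < K"
  shows "real K * f (vmean m K v) \<le> (\<Sum>k<K. f (v k))"
proof -
  define c where "c = vmean m K v"
  have c: "c \<in> carrier_vec m" unfolding c_def using v by (rule vmean_carrier)
  have "(\<Sum>k<K. f c + (g c \<bullet> v k - g c \<bullet> c)) \<le> (\<Sum>k<K. f (v k))"
  proof (rule sum_mono)
    fix k assume "k \<in> {..<K}"
    then show "f c + (g c \<bullet> v k - g c \<bullet> c) \<le> f (v k)"
      using tangent[OF c, of "v k"] v[of k] c g[OF c] by (simp add: scalar_prod_minus_distrib[of _ m])
  qed
  moreover have "(\<Sum>k<K. g c \<bullet> v k) = real K * (g c \<bullet> c)"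
    unfolding c_def using g[OF c] v K by (intro sum_scalar_prod_vmean) (auto simp: c_def)
  ultimately show ?thesis by (simp add: sum.distrib sum_subtractf c_def)
qed

text \<open>Both steps start at \<open>u\<close>. Expanding the squared norm of
  \<open>u' - w\<close> produces \<open>2 * \<gamma> * (h \<bullet> (u - w))\<close>; replacing
  \<open>u\<close> by \<open>uh + \<gamma> g\<close> and completing the square in
  \<open>h - g\<close> leaves the squared norm of \<open>\<gamma> g\<close>, that is, of
  \<open>uh - u\<close>. This is pure algebra in arbitrary \<open>g\<close> and \<open>h\<close>, so
  it serves each of the three variables.\<close>

lemma extragradient_step_identity:
  fixes u g h w :: "real vec"
  assumes c: "u \<in> carrier_vec m" "g \<in> carrier_vec m" "h \<in> carrier_vec m" "w \<in> carrier_vec m"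
    and half: "uh = u - \<gamma> \<cdot>\<^sub>v g" and full: "u' = u - \<gamma> \<cdot>\<^sub>v h"
  shows "2 * \<gamma> * (h \<bullet> (uh - w)) = (vnorm (u - w))\<^sup>2 - (vnorm (u' - w))\<^sup>2
    - (vnorm (uh - u))\<^sup>2 + \<gamma>\<^sup>2 * (vnorm (h - g))\<^sup>2"
  using c unfolding half full vnorm_power2
  by (simp add: scalar_prod_def sum_distrib_left sum.distrib[symmetric] sum_subtractf[symmetric]
      power2_eq_square algebra_simps)

text \<open>After scaling by \<gamma> both coefficients are at most 1/2, and the square of the mean
  of \<alpha> and \<beta> is at most the mean of their squares.\<close>

lemma power2_mult_vnorm_le:
  assumes "vnorm g \<le> a * \<alpha> + b * \<beta>" "0 \<le> \<gamma>" "0 \<le> \<alpha>" "0 \<le> \<beta>" "\<gamma> * a \<le> 1/2" "\<gamma> * b \<le> 1/2"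
  shows "\<gamma>\<^sup>2 * (vnorm g)\<^sup>2 \<le> (\<alpha>\<^sup>2 + \<beta>\<^sup>2) / 2"
proof -
  have "\<gamma> * vnorm g \<le> (\<gamma> * a) * \<alpha> + (\<gamma> * b) * \<beta>"
    using mult_left_mono[OF assms(1,2)] by (simp add: algebra_simps)
  also have "\<dots> \<le> (\<alpha> + \<beta>) / 2"
    using mult_right_mono[OF assms(5,3)] mult_right_mono[OF assms(6,4)] by simp
  finally have "(\<gamma> * vnorm g)\<^sup>2 \<le> ((\<alpha> + \<beta>) / 2)\<^sup>2"
    using assms(2) vnorm_nonneg[of g] by (intro power_mono) auto
  also have "\<dots> \<le> (\<alpha>\<^sup>2 + \<beta>\<^sup>2) / 2"
    using zero_le_power2[of "\<alpha> - \<beta>"] by (simp add: power2_eq_square field_simps)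
  finally show ?thesis by (simp add: power_mult_distrib)
qed

text \<open>The problem with all blocks merged into one variable of dimension \<open>q\<close>;
  \<open>p\<close> is the dimension of \<open>z\<close> and \<open>y\<close>. Convexity enters as
  tangent inequalities for \<open>gl\<close> and \<open>gR\<close>, and the step size through the
  five inequalities that the descent estimate uses.\<close>

locale extragradient =
  fixes p q :: nat and M :: "real mat" and l R :: "real vec \<Rightarrow> real" and gl gR :: "real vec \<Rightarrow> real vec"
    and Ll Lr \<sigma> \<gamma> :: real
  assumes M: "M \<in> carrier_mat p q"
    and gl: "\<And>u. u \<in> carrier_vec p \<Longrightarrow> gl u \<in> carrier_vec p"
    and gR: "\<And>u. u \<in> carrier_vec q \<Longrightarrow> gR u \<in> carrier_vec q"
    and l_tangent: "\<And>u v. u \<in> carrier_vec p \<Longrightarrow> v \<in> carrier_vec p \<Longrightarrow> l u + gl u \<bullet> (v - u) \<le> l v"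
    and R_tangent: "\<And>u v. u \<in> carrier_vec q \<Longrightarrow> v \<in> carrier_vec q \<Longrightarrow> R u + gR u \<bullet> (v - u) \<le> R v"
    and gl_lip: "\<And>u v. u \<in> carrier_vec p \<Longrightarrow> v \<in> carrier_vec p \<Longrightarrow>
      vnorm (gl u - gl v) \<le> Ll * vnorm (u - v)"
    and gR_lip: "\<And>u v. u \<in> carrier_vec q \<Longrightarrow> v \<in> carrier_vec q \<Longrightarrow>
      vnorm (gR u - gR v) \<le> Lr * vnorm (u - v)"
    and M_le: "\<And>v. v \<in> carrier_vec q \<Longrightarrow> vnorm (M *\<^sub>v v) \<le> \<sigma> * vnorm v"
    and MT_le: "\<And>w. w \<in> carrier_vec p \<Longrightarrow> vnorm (M\<^sup>T *\<^sub>v w) \<le> \<sigma> * vnorm w"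
    and \<gamma>: "0 < \<gamma>" "\<gamma> \<le> 1/2" "\<gamma> * \<sigma> \<le> 1/2" "\<gamma> * Ll \<le> 1/2" "\<gamma> * Lr \<le> 1/2"
begin

definition lag :: "real vec \<Rightarrow> real vec \<Rightarrow> real vec \<Rightarrow> real" where
  "lag x z y = l z + R x + y \<bullet> (M *\<^sub>v x - z)"

lemma MT_scalar_prod:
  "x \<in> carrier_vec q \<Longrightarrow> y \<in> carrier_vec p \<Longrightarrow> (M\<^sup>T *\<^sub>v y) \<bullet> x = y \<bullet> (M *\<^sub>v x)"
  using M by (rule transpose_vec_mult_scalar)

lemma M_carrier: "x \<in> carrier_vec q \<Longrightarrow> M *\<^sub>v x \<in> carrier_vec p"
  using M by simp

lemma MT_carrier: "y \<in> carrier_vec p \<Longrightarrow> M\<^sup>T *\<^sub>v y \<in> carrier_vec q"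
  using M by simp

text \<open>The right-hand side pairs the monotone saddle operator
  \<open>(M\<^sup>T y + \<nabla>R x, \<nabla>l z - y, z - M x)\<close> with the displacement.\<close>
lemma lag_diff_le:
  assumes c: "x \<in> carrier_vec q" "z \<in> carrier_vec p" "y \<in> carrier_vec p"
    "x' \<in> carrier_vec q" "z' \<in> carrier_vec p" "y' \<in> carrier_vec p"
  shows "lag x z y' - lag x' z' y \<le>
    (M\<^sup>T *\<^sub>v y + gR x) \<bullet> (x - x') + (gl z - y) \<bullet> (z - z') + (z - M *\<^sub>v x) \<bullet> (y - y')"
proof -
  have "gR x \<bullet> (x' - x) = - (gR x \<bullet> (x - x'))" "gl z \<bullet> (z' - z) = - (gl z \<bullet> (z - z'))"
    using c gR[of x] gl[of z] by (simp_all add: scalar_prod_minus_distrib[of _ q] scalar_prod_minus_distrib[of _ p])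
  then have "R x - R x' \<le> gR x \<bullet> (x - x')" "l z - l z' \<le> gl z \<bullet> (z - z')"
    using R_tangent[of x x'] l_tangent[of z z'] c by simp_all
  moreover have "(M\<^sup>T *\<^sub>v y + gR x) \<bullet> (x - x') = y \<bullet> (M *\<^sub>v x) - y \<bullet> (M *\<^sub>v x') + gR x \<bullet> (x - x')"
    using c gR[of x] MT_carrier[of y]
    by (simp add: add_scalar_prod_distrib[of _ q] scalar_prod_minus_distrib[of _ q x x'] MT_scalar_prod)
  moreover have "(gl z - y) \<bullet> (z - z') = gl z \<bullet> (z - z') - y \<bullet> z + y \<bullet> z'"
    using c gl[of z]
    by (simp add: minus_scalar_prod_distrib[of _ p] scalar_prod_minus_distrib[of _ p])
  moreover have "(z - M *\<^sub>v x) \<bullet> (y - y') = y \<bullet> z - y' \<bullet> z - y \<bullet> (M *\<^sub>v x) + y' \<bullet> (M *\<^sub>v x)"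
    using c M_carrier[of x] comm_scalar_prod[of z p y] comm_scalar_prod[of z p y']
      comm_scalar_prod[of "M *\<^sub>v x" p y] comm_scalar_prod[of "M *\<^sub>v x" p y']
    by (simp add: minus_scalar_prod_distrib[of _ p] scalar_prod_minus_distrib[of _ p])
  moreover have "y' \<bullet> (M *\<^sub>v x - z) = y' \<bullet> (M *\<^sub>v x) - y' \<bullet> z" "y \<bullet> (M *\<^sub>v x' - z') = y \<bullet> (M *\<^sub>v x') - y \<bullet> z'"
    using c M_carrier[of x] M_carrier[of x'] by (simp_all add: scalar_prod_minus_distrib[of _ p])
  \<comment> \<open>The bilinear contributions of both sides coincide; only the two tangent
    inequalities are lossy.\<close>
  ultimately show ?thesis unfolding lag_def by linarith
qed

text \<open>The components depend on the displacements of \<open>(y, x)\<close>,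
  \<open>(z, y)\<close> and \<open>(z, x)\<close> respectively, each with weight 1/2 after squaring.
  Every displacement therefore has total weight 1, which is exactly what the negative terms of the
  step identities can absorb.\<close>

lemma operator_diff_le:
  assumes c: "x \<in> carrier_vec q" "z \<in> carrier_vec p" "y \<in> carrier_vec p"
    "x' \<in> carrier_vec q" "z' \<in> carrier_vec p" "y' \<in> carrier_vec p"
  shows "\<gamma>\<^sup>2 * (vnorm ((M\<^sup>T *\<^sub>v y + gR x) - (M\<^sup>T *\<^sub>v y' + gR x')))\<^sup>2
    + \<gamma>\<^sup>2 * (vnorm ((gl z - y) - (gl z' - y')))\<^sup>2
    + \<gamma>\<^sup>2 * (vnorm ((z - M *\<^sub>v x) - (z' - M *\<^sub>v x')))\<^sup>2
    \<le> (vnorm (x - x'))\<^sup>2 + (vnorm (z - z'))\<^sup>2 + (vnorm (y - y'))\<^sup>2"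
proof -
  note carr = c gR[OF c(1)] gR[OF c(4)] gl[OF c(2)] gl[OF c(5)] M_carrier[OF c(1)] M_carrier[OF c(4)]
    MT_carrier[OF c(3)] MT_carrier[OF c(6)]
  have "(M\<^sup>T *\<^sub>v y + gR x) - (M\<^sup>T *\<^sub>v y' + gR x') = M\<^sup>T *\<^sub>v (y - y') + (gR x - gR x')"
    using carr M by (subst mult_minus_distrib_mat_vec[of _ q p]) auto
  then have "vnorm ((M\<^sup>T *\<^sub>v y + gR x) - (M\<^sup>T *\<^sub>v y' + gR x')) \<le> \<sigma> * vnorm (y - y') + Lr * vnorm (x - x')"
    using vnorm_add_le[of "M\<^sup>T *\<^sub>v (y - y')" q "gR x - gR x'"] MT_carrier[of "y - y'"] carr
      MT_le[of "y - y'"] gR_lip[of x x'] by simp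
  then have 1: "\<gamma>\<^sup>2 * (vnorm ((M\<^sup>T *\<^sub>v y + gR x) - (M\<^sup>T *\<^sub>v y' + gR x')))\<^sup>2
      \<le> ((vnorm (y - y'))\<^sup>2 + (vnorm (x - x'))\<^sup>2) / 2"
    by (rule power2_mult_vnorm_le) (use \<gamma> in \<open>simp_all add: vnorm_nonneg\<close>)
  have "(gl z - y) - (gl z' - y') = (gl z - gl z') - (y - y')"
    using carr by auto
  then have "vnorm ((gl z - y) - (gl z' - y')) \<le> Ll * vnorm (z - z') + 1 * vnorm (y - y')"
    using vnorm_diff_le[of "gl z - gl z'" p "y - y'"] carr gl_lip[of z z'] by simp
  then have 2: "\<gamma>\<^sup>2 * (vnorm ((gl z - y) - (gl z' - y')))\<^sup>2 \<le> ((vnorm (z - z'))\<^sup>2 + (vnorm (y - y'))\<^sup>2) / 2"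
    by (rule power2_mult_vnorm_le) (use \<gamma> in \<open>simp_all add: vnorm_nonneg\<close>)
  have "(z - M *\<^sub>v x) - (z' - M *\<^sub>v x') = (z - z') - M *\<^sub>v (x - x')"
    using carr M by (subst mult_minus_distrib_mat_vec[of _ p q]) auto
  then have "vnorm ((z - M *\<^sub>v x) - (z' - M *\<^sub>v x')) \<le> 1 * vnorm (z - z') + \<sigma> * vnorm (x - x')"
    using vnorm_diff_le[of "z - z'" p "M *\<^sub>v (x - x')"] M_carrier[of "x - x'"] carr
      M_le[of "x - x'"] by simp
  then have 3: "\<gamma>\<^sup>2 * (vnorm ((z - M *\<^sub>v x) - (z' - M *\<^sub>v x')))\<^sup>2 \<le> ((vnorm (z - z'))\<^sup>2 + (vnorm (x - x'))\<^sup>2) / 2"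
    by (rule power2_mult_vnorm_le) (use \<gamma> in \<open>simp_all add: vnorm_nonneg\<close>)
  from 1 2 3 show ?thesis by argo
qed

text \<open>For a fixed comparison point the squared distance \<open>E\<close> to it decreases at
  each step by at least the scaled difference of Lagrangians, and the sum telescopes. Passing to
  averages uses Jensen's inequality for \<open>l\<close> and \<open>R\<close>, while the coupling
  terms are linear in the iterates and average exactly.\<close>

lemma lag_vmean_diff_le:
  assumes K: "0 < K"
    and c: "\<And>k. k \<le> K \<Longrightarrow> x k \<in> carrier_vec q" "\<And>k. k \<le> K \<Longrightarrow> z k \<in> carrier_vec p"
      "\<And>k. k \<le> K \<Longrightarrow> y k \<in> carrier_vec p"
    and ch: "\<And>k. k < K \<Longrightarrow> xh k \<in> carrier_vec q" "\<And>k. k < K \<Longrightarrow> zh k \<in> carrier_vec p"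
      "\<And>k. k < K \<Longrightarrow> yh k \<in> carrier_vec p"
    and half: "\<And>k. k < K \<Longrightarrow> xh k = x k - \<gamma> \<cdot>\<^sub>v (M\<^sup>T *\<^sub>v y k + gR (x k))"
      "\<And>k. k < K \<Longrightarrow> zh k = z k - \<gamma> \<cdot>\<^sub>v (gl (z k) - y k)"
      "\<And>k. k < K \<Longrightarrow> yh k = y k + \<gamma> \<cdot>\<^sub>v (M *\<^sub>v x k - z k)"
    and full: "\<And>k. k < K \<Longrightarrow> x (Suc k) = x k - \<gamma> \<cdot>\<^sub>v (M\<^sup>T *\<^sub>v yh k + gR (xh k))"
      "\<And>k. k < K \<Longrightarrow> z (Suc k) = z k - \<gamma> \<cdot>\<^sub>v (gl (zh k) - yh k)"
      "\<And>k. k < K \<Longrightarrow> y (Suc k) = y k + \<gamma> \<cdot>\<^sub>v (M *\<^sub>v xh k - zh k)"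
    and c': "x' \<in> carrier_vec q" "z' \<in> carrier_vec p" "y' \<in> carrier_vec p"
  shows "2 * \<gamma> * real K * (lag (vmean q K xh) (vmean p K zh) y' - lag x' z' (vmean p K yh))
    \<le> (vnorm (x 0 - x'))\<^sup>2 + (vnorm (z 0 - z'))\<^sup>2 + (vnorm (y 0 - y'))\<^sup>2"
proof -
  define E where "E k = (vnorm (x k - x'))\<^sup>2 + (vnorm (z k - z'))\<^sup>2 + (vnorm (y k - y'))\<^sup>2" for k
  have step: "2 * \<gamma> * (lag (xh k) (zh k) y' - lag x' z' (yh k)) \<le> E k - E (Suc k)" if k: "k < K" for k
  proof -
    have kc: "x k \<in> carrier_vec q" "z k \<in> carrier_vec p" "y k \<in> carrier_vec p" using c k by auto
    note hc = ch[OF k]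
    note carr = kc hc c' gR[OF kc(1)] gR[OF hc(1)] gl[OF kc(2)] gl[OF hc(2)] M_carrier[OF kc(1)]
      M_carrier[OF hc(1)] MT_carrier[OF kc(3)] MT_carrier[OF hc(3)]
    \<comment> \<open>The ascent in \<open>y\<close> is rewritten as a descent along
      \<open>z - M x\<close>, so that the same step identity applies to all three variables.\<close>
    have y: "yh k = y k - \<gamma> \<cdot>\<^sub>v (z k - M *\<^sub>v x k)" "y (Suc k) = y k - \<gamma> \<cdot>\<^sub>v (zh k - M *\<^sub>v xh k)"
      unfolding half(3)[OF k] full(3)[OF k] using carr M by (auto simp: algebra_simps)
    define gx where "gx = M\<^sup>T *\<^sub>v yh k + gR (xh k)"
    define gz where "gz = gl (zh k) - yh k"
    define gy where "gy = zh k - M *\<^sub>v xh k"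
    have "2 * \<gamma> * (gx \<bullet> (xh k - x')) = (vnorm (x k - x'))\<^sup>2 - (vnorm (x (Suc k) - x'))\<^sup>2
      - (vnorm (xh k - x k))\<^sup>2 + \<gamma>\<^sup>2 * (vnorm (gx - (M\<^sup>T *\<^sub>v y k + gR (x k))))\<^sup>2"
      using half(1)[OF k] full(1)[OF k] carr unfolding gx_def
      by (intro extragradient_step_identity[of _ q]) auto
    moreover have "2 * \<gamma> * (gz \<bullet> (zh k - z')) = (vnorm (z k - z'))\<^sup>2 - (vnorm (z (Suc k) - z'))\<^sup>2
      - (vnorm (zh k - z k))\<^sup>2 + \<gamma>\<^sup>2 * (vnorm (gz - (gl (z k) - y k)))\<^sup>2"
      using half(2)[OF k] full(2)[OF k] carr unfolding gz_def
      by (intro extragradient_step_identity[of _ p]) auto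
    moreover have "2 * \<gamma> * (gy \<bullet> (yh k - y')) = (vnorm (y k - y'))\<^sup>2 - (vnorm (y (Suc k) - y'))\<^sup>2
      - (vnorm (yh k - y k))\<^sup>2 + \<gamma>\<^sup>2 * (vnorm (gy - (z k - M *\<^sub>v x k)))\<^sup>2"
      using y carr unfolding gy_def
      by (intro extragradient_step_identity[of _ p]) auto
    \<comment> \<open>The operator is compared at the half step and at the current iterate; this
      cancels the squared displacements in the three identities.\<close>
    moreover note operator_diff_le[OF hc kc, folded gx_def gz_def gy_def]
    moreover have "2 * \<gamma> * (lag (xh k) (zh k) y' - lag x' z' (yh k))
        \<le> 2 * \<gamma> * (gx \<bullet> (xh k - x') + gz \<bullet> (zh k - z') + gy \<bullet> (yh k - y'))"
      using lag_diff_le[OF hc c'] \<gamma>(1) unfolding gx_def gz_def gy_def by (intro mult_left_mono) auto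
    ultimately show ?thesis unfolding E_def distrib_left by linarith
  qed
  have "(\<Sum>k<K. 2 * \<gamma> * (lag (xh k) (zh k) y' - lag x' z' (yh k))) \<le> (\<Sum>k<K. E k - E (Suc k))"
    using step by (intro sum_mono) auto
  also have "\<dots> = E 0 - E K" by (rule sum_lessThan_telescope')
  also have "\<dots> \<le> E 0"
  proof -
    have "0 \<le> E K" unfolding E_def by (intro add_nonneg_nonneg zero_le_power2)
    then show ?thesis by simp
  qed
  finally have tele: "2 * \<gamma> * (\<Sum>k<K. lag (xh k) (zh k) y' - lag x' z' (yh k)) \<le> E 0"
    by (simp add: sum_distrib_left)
  define mx mz my where "mx = vmean q K xh" and "mz = vmean p K zh" and "my = vmean p K yh"
  have mc: "mx \<in> carrier_vec q" "mz \<in> carrier_vec p" "my \<in> carrier_vec p"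
    unfolding mx_def mz_def my_def using ch by (auto intro: vmean_carrier)
  have "real K * R mx \<le> (\<Sum>k<K. R (xh k))" "real K * l mz \<le> (\<Sum>k<K. l (zh k))"
    unfolding mx_def mz_def
    using jensen_vmean[OF R_tangent gR ch(1) K] jensen_vmean[OF l_tangent gl ch(2) K] by auto
  moreover have "(\<Sum>k<K. y' \<bullet> (M *\<^sub>v xh k - zh k)) = real K * (y' \<bullet> (M *\<^sub>v mx - mz))"
  proof -
    \<comment> \<open>Moving \<open>M\<close> to the side of \<open>y'\<close> turns each term into
      a scalar product with a fixed vector, which commutes with averaging.\<close>
    have "(\<Sum>k<K. y' \<bullet> (M *\<^sub>v xh k - zh k)) = (\<Sum>k<K. (M\<^sup>T *\<^sub>v y') \<bullet> xh k) - (\<Sum>k<K. y' \<bullet> zh k)"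
      unfolding sum_subtractf[symmetric] using ch c' M_carrier[OF ch(1)]
      by (intro sum.cong) (auto simp: MT_scalar_prod scalar_prod_minus_distrib[of _ p])
    also have "\<dots> = real K * ((M\<^sup>T *\<^sub>v y') \<bullet> mx) - real K * (y' \<bullet> mz)"
      unfolding mx_def mz_def using ch c' K MT_carrier by (simp add: sum_scalar_prod_vmean)
    also have "\<dots> = real K * (y' \<bullet> (M *\<^sub>v mx - mz))"
      using c' mc M_carrier[OF mc(1)]
      by (simp add: MT_scalar_prod scalar_prod_minus_distrib[of _ p] right_diff_distrib)
    finally show ?thesis .
  qed
  moreover have "(\<Sum>k<K. yh k \<bullet> (M *\<^sub>v x' - z')) = real K * (my \<bullet> (M *\<^sub>v x' - z'))"
  proof -
    have w: "M *\<^sub>v x' - z' \<in> carrier_vec p" using c' M_carrier by simp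
    have "(\<Sum>k<K. yh k \<bullet> (M *\<^sub>v x' - z')) = (\<Sum>k<K. (M *\<^sub>v x' - z') \<bullet> yh k)"
      using ch w by (intro sum.cong) (auto intro: comm_scalar_prod)
    also have "\<dots> = real K * ((M *\<^sub>v x' - z') \<bullet> my)"
      unfolding my_def using ch(3) w K by (intro sum_scalar_prod_vmean) auto
    finally show ?thesis using comm_scalar_prod[OF w mc(3)] by simp
  qed
  ultimately have "real K * (lag mx mz y' - lag x' z' my)
      \<le> (\<Sum>k<K. lag (xh k) (zh k) y' - lag x' z' (yh k))"
    unfolding lag_def by (simp add: sum.distrib sum_subtractf algebra_simps)
  then have "2 * \<gamma> * (real K * (lag mx mz y' - lag x' z' my))
      \<le> 2 * \<gamma> * (\<Sum>k<K. lag (xh k) (zh k) y' - lag x' z' (yh k))"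
    using \<gamma>(1) by (intro mult_left_mono) auto
  with tele show ?thesis by (simp add: E_def mx_def mz_def my_def mult.assoc)
qed

end

subsection \<open>Block vectors\<close>

lemma sum_lessThan_blocks:
  fixes f :: "nat \<Rightarrow> 'a::comm_monoid_add" and n :: nat
  shows "(\<Sum>j<(\<Sum>k<n. d k). f j) = (\<Sum>i<n. \<Sum>j<d i. f ((\<Sum>k<i. d k) + j))"
proof (induction n)
  case (Suc n)
  have "(\<Sum>j<a + b. f j) = (\<Sum>j<a. f j) + (\<Sum>j<b. f (a + j))" for a b
    by (induction b) (auto simp: add.assoc)
  then show ?case by (simp add: Suc)
qed simp

lemma block_index_less:
  fixes d :: "nat \<Rightarrow> nat"
  assumes "i < n" "j < d i"
  shows "(\<Sum>k<i. d k) + j < (\<Sum>k<n. d k)"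
proof -
  have "(\<Sum>k<i. d k) + d i = (\<Sum>k<Suc i. d k)" by simp
  also have "\<dots> \<le> (\<Sum>k<n. d k)" using assms(1) by (intro sum_mono2) auto
  finally show ?thesis using assms(2) by linarith
qed

lemma block_index_exhaust:
  fixes d :: "nat \<Rightarrow> nat"
  assumes "j < (\<Sum>k<n. d k)"
  shows "\<exists>i<n. \<exists>j'<d i. j = (\<Sum>k<i. d k) + j'"
  using assms
proof (induction n)
  case (Suc n)
  show ?case
  proof (cases "j < (\<Sum>k<n. d k)")
    case True
    then show ?thesis using Suc.IH less_SucI by blast
  next
    case False
    then show ?thesis using Suc.prems by (intro exI[of _ n] exI[of _ "j - (\<Sum>k<n. d k)"] conjI) auto
  qed
qed simp

lemma length_concat_upt: "length (concat (map f [0..<n])) = (\<Sum>k<n. length (f k))"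
  by (induction n) auto

text \<open>The common fact behind the indexing of \<open>vconcat\<close> and
  \<open>hconcat\<close>: block \<open>i\<close> of a flattened list starts at the total length of
  the earlier blocks.\<close>

lemma nth_concat_upt:
  assumes "i < n" "j < length (f i)"
  shows "concat (map f [0..<n]) ! ((\<Sum>k<i. length (f k)) + j) = f i ! j"
  using assms
proof (induction n)
  case (Suc n)
  then show ?case
    using block_index_less[of i n j "\<lambda>k. length (f k)"]
    by (cases "i = n") (auto simp: nth_append length_concat_upt)
qed simp

section \<open>Components of a concatenated vector\<close>

lemma block_carrier [simp]: "block d i u \<in> carrier_vec (d i)"
  by (simp add: block_def)

text \<open>Every index lies in some block. This turns the blockwise updates of the algorithm into
  one update of the whole vector.\<close>

lemma block_eqI:
  assumes "u \<in> carrier_vec (\<Sum>i<n. d i)" "v \<in> carrier_vec (\<Sum>i<n. d i)"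
    and "\<And>i. i < n \<Longrightarrow> block d i u = block d i v"
  shows "u = v"
proof (rule eq_vecI)
  fix j assume "j < dim_vec v"
  then obtain i j' where j: "i < n" "j' < d i" "j = (\<Sum>k<i. d k) + j'"
    using assms(2) block_index_exhaust[of j d n] by auto
  have "block d i u $ j' = block d i v $ j'" using assms(3)[OF j(1)] by simp
  then show "u $ j = v $ j" using j by (simp add: block_def)
qed (use assms in auto)

lemma scalar_prod_blocks:
  fixes u v :: "real vec"
  assumes "v \<in> carrier_vec (\<Sum>i<n. d i)"
  shows "u \<bullet> v = (\<Sum>i<n. block d i u \<bullet> block d i v)"
  using assms by (simp add: scalar_prod_def atLeast0LessThan sum_lessThan_blocks block_def)

lemma block_add:
  assumes "i < n" "u \<in> carrier_vec (\<Sum>i<n. d i)" "v \<in> carrier_vec (\<Sum>i<n. d i)"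
  shows "block d i (u + v) = block d i u + block d i v"
  using assms block_index_less[of i n _ d] by (auto simp: block_def)

lemma block_diff:
  assumes "i < n" "u \<in> carrier_vec (\<Sum>i<n. d i)" "v \<in> carrier_vec (\<Sum>i<n. d i)"
  shows "block d i (u - v) = block d i u - block d i v"
  using assms block_index_less[of i n _ d] by (auto simp: block_def)

lemma block_smult:
  assumes "i < n" "u \<in> carrier_vec (\<Sum>i<n. d i)"
  shows "block d i (c \<cdot>\<^sub>v u) = c \<cdot>\<^sub>v block d i u"
  using assms block_index_less[of i n _ d] by (auto simp: block_def)

text \<open>A right inverse of taking blocks, used to assemble the gradients of the
  \<open>r i\<close> into one vector. Going through lists, as \<open>hconcat\<close> does, lets one
  index lemma serve both.\<close>

definition vconcat :: "nat \<Rightarrow> (nat \<Rightarrow> real vec) \<Rightarrow> real vec" where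
  "vconcat n g = vec_of_list (concat (map (\<lambda>i. list_of_vec (g i)) [0..<n]))"

lemma vconcat_carrier:
  assumes "\<And>i. i < n \<Longrightarrow> g i \<in> carrier_vec (d i)"
  shows "vconcat n g \<in> carrier_vec (\<Sum>i<n. d i)"
proof -
  have "dim_vec (g i) = d i" if "i < n" for i using assms[OF that] by simp
  then show ?thesis by (intro carrier_vecI) (simp add: vconcat_def length_concat_upt)
qed

lemma block_vconcat:
  assumes g: "\<And>i. i < n \<Longrightarrow> g i \<in> carrier_vec (d i)" and i: "i < n"
  shows "block d i (vconcat n g) = g i"
proof (rule eq_vecI)
  fix j assume "j < dim_vec (g i)"
  then have j: "j < d i" using g[OF i] by simp
  have "dim_vec (g k) = d k" if "k < i" for k using g[of k] i that by simp
  then have "(\<Sum>k<i. d k) = (\<Sum>k<i. length (list_of_vec (g k)))" by simp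
  then show "block d i (vconcat n g) $ j = g i $ j"
    using j g[OF i] nth_concat_upt[OF i, of j "\<lambda>i. list_of_vec (g i)"]
    by (simp add: block_def vconcat_def vec_of_list_index)
qed (use g[OF i] in \<open>simp add: block_def\<close>)

section \<open>The block matrix and its transpose\<close>

context
  fixes n s :: nat and d :: "nat \<Rightarrow> nat" and A :: "nat \<Rightarrow> real mat"
  assumes A: "\<And>i. i < n \<Longrightarrow> A i \<in> carrier_mat s (d i)"
begin

lemma hconcat_carrier: "hconcat n s A \<in> carrier_mat s (\<Sum>i<n. d i)"
proof -
  have "dim_col (A i) = d i" if "i < n" for i using A[OF that] by simp
  then show ?thesis by (intro carrier_matI) (simp_all add: hconcat_def length_concat_upt)
qed

lemma hconcat_index:
  assumes "i < n" "j < d i" "t < s"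
  shows "hconcat n s A $$ (t, (\<Sum>k<i. d k) + j) = A i $$ (t, j)"
proof -
  have "dim_col (A k) = d k" if "k < i" for k using A[of k] assms(1) that by simp
  then have eq: "(\<Sum>k<i. d k) = (\<Sum>k<i. length (cols (A k)))" by simp
  have "(\<Sum>k<i. d k) + j < length (concat (map (\<lambda>i. cols (A i)) [0..<n]))"
    using carrier_matD(2)[OF hconcat_carrier] block_index_less[of i n j d] assms by (simp add: hconcat_def)
  then show ?thesis
    using nth_concat_upt[OF assms(1), of j "\<lambda>i. cols (A i)"] assms A[OF assms(1)]
    by (simp add: hconcat_def mat_of_cols_index eq)
qed

text \<open>Identifies the coupling sum of the algorithm with the product by a single matrix, to
  which the spectral bounds apply.\<close>

lemma hconcat_mult_vec:
  assumes x: "x \<in> carrier_vec (\<Sum>i<n. d i)"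
  shows "hconcat n s A *\<^sub>v x = vsum s (\<lambda>i. A i *\<^sub>v block d i x) n"
proof (rule eq_vecI)
  have c: "A i *\<^sub>v block d i x \<in> carrier_vec s" if "i < n" for i
    using A[OF that] by simp
  then have vc: "vsum s (\<lambda>i. A i *\<^sub>v block d i x) n \<in> carrier_vec s"
    by (rule vsum_carrier)
  then show "dim_vec (hconcat n s A *\<^sub>v x) = dim_vec (vsum s (\<lambda>i. A i *\<^sub>v block d i x) n)"
    using hconcat_carrier by simp
  fix t assume "t < dim_vec (vsum s (\<lambda>i. A i *\<^sub>v block d i x) n)"
  then have t: "t < s" using vc by simp
  have "(hconcat n s A *\<^sub>v x) $ t = (\<Sum>j<(\<Sum>i<n. d i). hconcat n s A $$ (t, j) * x $ j)"
    using t x hconcat_carrier by (simp add: scalar_prod_def atLeast0LessThan)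
  also have "\<dots> = (\<Sum>i<n. \<Sum>j<d i. A i $$ (t, j) * block d i x $ j)"
    unfolding sum_lessThan_blocks using t by (intro sum.cong) (auto simp: hconcat_index block_def)
  also have "\<dots> = (\<Sum>i<n. (A i *\<^sub>v block d i x) $ t)"
  proof (rule sum.cong)
    fix i assume "i \<in> {..<n}"
    then show "(\<Sum>j<d i. A i $$ (t, j) * block d i x $ j) = (A i *\<^sub>v block d i x) $ t"
      using t A[of i] by (simp add: scalar_prod_def atLeast0LessThan block_def)
  qed simp
  also have "\<dots> = vsum s (\<lambda>i. A i *\<^sub>v block d i x) n $ t"
    using t c by (simp add: index_finsum_vec)
  finally show "(hconcat n s A *\<^sub>v x) $ t = vsum s (\<lambda>i. A i *\<^sub>v block d i x) n $ t" .
qed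

text \<open>The dual counterpart: the coupling directions in the separate \<open>x\<close> updates
  are the blocks of a single vector.\<close>

lemma block_hconcat_transpose_mult_vec:
  assumes y: "y \<in> carrier_vec s" and i: "i < n"
  shows "block d i ((hconcat n s A)\<^sup>T *\<^sub>v y) = (A i)\<^sup>T *\<^sub>v y"
proof (rule eq_vecI)
  fix j assume "j < dim_vec ((A i)\<^sup>T *\<^sub>v y)"
  then have j: "j < d i" using A[OF i] by simp
  then have "(\<Sum>k<i. d k) + j < (\<Sum>k<n. d k)" using i by (rule block_index_less[rotated])
  then show "block d i ((hconcat n s A)\<^sup>T *\<^sub>v y) $ j = ((A i)\<^sup>T *\<^sub>v y) $ j"
    using j i y A[OF i] hconcat_carrier
    by (auto simp: block_def scalar_prod_def hconcat_index intro!: sum.cong)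
qed (use A[OF i] in \<open>simp add: block_def\<close>)

end

subsection \<open>Step size, diameter and gap\<close>

text \<open>The minimum lies below each of its entries, which gives the upper bounds. It is also
  attained: with \<open>\<mu> = 2 * \<gamma>\<close>, one of \<mu>, \<open>\<mu> * \<sigma>\<close>,
  \<open>\<mu> * Lr\<close>, \<open>\<mu> * Ll\<close> equals 1 and the others are nonnegative, so
  their sum is at least 1.\<close>

lemma stepsize_bounds:
  assumes \<gamma>: "ereal \<gamma> = 1 / 2 * Min {1, 1 / ereal \<sigma>, 1 / ereal Lr, 1 / ereal Ll}"
    and pos: "0 \<le> \<sigma>" "0 < Lr" "0 < Ll"
  shows "0 < \<gamma>" "\<gamma> \<le> 1/2" "\<gamma> * \<sigma> \<le> 1/2" "\<gamma> * Ll \<le> 1/2" "\<gamma> * Lr \<le> 1/2"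
    and "1 \<le> 2 * \<gamma> * (1 + \<sigma> + Ll + Lr)"
proof -
  define S where "S = {1, 1 / ereal \<sigma>, 1 / ereal Lr, 1 / ereal Ll}"
  have S: "finite S" "S \<noteq> {}" by (auto simp: S_def)
  have inv: "1 / ereal a = (if a = 0 then \<infinity> else ereal (1 / a))" for a
    by (simp add: one_ereal_def divide_ereal_def inverse_eq_divide)
  have "0 < Min S"
    using S pos by (auto simp: S_def inv)
  moreover have "Min S \<le> 1" using S by (intro Min_le) (auto simp: S_def)
  \<comment> \<open>The entry 1 keeps the minimum finite, so it is a real number even if another
    entry is infinite.\<close>
  ultimately obtain \<mu> where \<mu>: "Min S = ereal \<mu>" "0 < \<mu>"
    by (cases "Min S") auto
  have half: "(1 / 2 :: ereal) = ereal (1 / 2)"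
    by (simp add: one_ereal_def numeral_eq_ereal)
  have "ereal \<gamma> = ereal (\<mu> / 2)" using \<gamma> \<mu>(1) by (simp add: S_def half)
  then have \<mu>\<gamma>: "\<mu> = 2 * \<gamma>" by simp
  have le: "ereal \<mu> \<le> a" if "a \<in> S" for a
    unfolding \<mu>(1)[symmetric] using S(1) that by (rule Min_le)
  have 1: "\<mu> \<le> 1" using le[of 1] by (simp add: S_def)
  \<comment> \<open>For \<open>\<sigma> = 0\<close> the corresponding entry is infinite and the
    bound is trivial.\<close>
  have 2: "\<mu> * \<sigma> \<le> 1"
    using le[of "1 / ereal \<sigma>"] pos by (cases "\<sigma> = 0") (simp_all add: S_def inv le_divide_eq)
  have 3: "\<mu> * Lr \<le> 1" "\<mu> * Ll \<le> 1"
    using le[of "1 / ereal Lr"] le[of "1 / ereal Ll"] pos by (simp_all add: S_def inv le_divide_eq)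
  show "0 < \<gamma>" "\<gamma> \<le> 1/2" "\<gamma> * \<sigma> \<le> 1/2" "\<gamma> * Ll \<le> 1/2" "\<gamma> * Lr \<le> 1/2"
    using 1 2 3 \<mu>(2) by (simp_all add: \<mu>\<gamma>)
  have "ereal \<mu> \<in> S" unfolding \<mu>(1)[symmetric] using S by (rule Min_in)
  then have "\<mu> = 1 \<or> \<mu> * \<sigma> = 1 \<or> \<mu> * Lr = 1 \<or> \<mu> * Ll = 1"
    using pos by (auto simp: S_def inv one_ereal_def split: if_splits)
  moreover have "0 \<le> \<mu> * \<sigma>" "0 \<le> \<mu> * Lr" "0 \<le> \<mu> * Ll" using \<mu>(2) pos by simp_all
  ultimately have "1 \<le> \<mu> * (1 + \<sigma> + Ll + Lr)"
    using \<mu>(2) by (simp only: distrib_left mult_1_right) linarith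
  then show "1 \<le> 2 * \<gamma> * (1 + \<sigma> + Ll + Lr)" by (simp add: \<mu>\<gamma>)
qed

lemma compactin_euclid_topology_bounded:
  assumes S: "compactin (euclid_topology m) S" and u: "u \<in> carrier_vec m"
  obtains B where "S \<subseteq> carrier_vec m" "\<And>v. v \<in> S \<Longrightarrow> (vnorm (u - v))\<^sup>2 \<le> B"
proof -
  interpret Metric_space "carrier_vec m" "vdist m" by (rule Metric_space_vdist)
  have "mbounded S" using S unfolding euclid_topology_def by (rule compactin_imp_mbounded)
  \<comment> \<open>With \<open>u\<close> added to the set, the bound on pairwise distances also
    bounds the distances from \<open>u\<close>.\<close>
  then have "mbounded (insert u S)" using u by (simp add: mbounded_insert)
  then obtain B where B: "S \<subseteq> carrier_vec m" "\<And>v. v \<in> S \<Longrightarrow> vdist m u v \<le> B"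
    unfolding mbounded_alt by auto
  have "(vnorm (u - v))\<^sup>2 \<le> B\<^sup>2" if "v \<in> S" for v
    using B(2)[OF that] B(1) that u vdist_eq_vnorm[of u m v]
    by (intro power_mono) (auto simp: vnorm_nonneg)
  then show thesis using B(1) that by blast
qed

text \<open>A real supremum dominates its members once the set is bounded above; compactness of the
  three factors provides the bound.\<close>

lemma le_diam_sq:
  assumes X: "compactin (euclid_topology q) X" and Z: "compactin (euclid_topology p) Z"
    and Y: "compactin (euclid_topology p) Y"
    and c: "x0 \<in> carrier_vec q" "z0 \<in> carrier_vec p" "y0 \<in> carrier_vec p"
    and i: "x \<in> X" "z \<in> Z" "y \<in> Y"
  shows "(vnorm (x0 - x))\<^sup>2 + (vnorm (z0 - z))\<^sup>2 + (vnorm (y0 - y))\<^sup>2 \<le> diam_sq X Z Y x0 z0 y0"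
proof -
  obtain B1 where 1: "\<And>v. v \<in> X \<Longrightarrow> (vnorm (x0 - v))\<^sup>2 \<le> B1"
    using compactin_euclid_topology_bounded[OF X c(1)] by blast
  obtain B2 where 2: "\<And>v. v \<in> Z \<Longrightarrow> (vnorm (z0 - v))\<^sup>2 \<le> B2"
    using compactin_euclid_topology_bounded[OF Z c(2)] by blast
  obtain B3 where 3: "\<And>v. v \<in> Y \<Longrightarrow> (vnorm (y0 - v))\<^sup>2 \<le> B3"
    using compactin_euclid_topology_bounded[OF Y c(3)] by blast
  let ?f = "\<lambda>(x, z, y). (vnorm (x0 - x))\<^sup>2 + (vnorm (z0 - z))\<^sup>2 + (vnorm (y0 - y))\<^sup>2"
  have "bdd_above (?f ` (X \<times> Z \<times> Y))"
    by (rule bdd_aboveI[of _ "B1 + B2 + B3"]) (auto intro!: add_mono 1 2 3)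
  from cSUP_upper[OF _ this, of "(x, z, y)"] i show ?thesis by (simp add: diam_sq_def)
qed

text \<open>A bound that is uniform over all comparison points passes first to the infimum and then
  to the supremum, both over nonempty sets.\<close>

lemma gap_le:
  assumes "X \<noteq> {}" "Z \<noteq> {}" "Y \<noteq> {}"
    and le: "\<And>x' z' y'. x' \<in> X \<Longrightarrow> z' \<in> Z \<Longrightarrow> y' \<in> Y \<Longrightarrow>
      lagrangian n s d A ell b r x z y' - lagrangian n s d A ell b r x' z' y \<le> B"
  shows "gap n s d A ell b r X Z Y x z y \<le> B"
proof -
  let ?I = "INF (x', z')\<in>X \<times> Z. lagrangian n s d A ell b r x' z' y"
  have "lagrangian n s d A ell b r x z y' \<le> ?I + B" if "y' \<in> Y" for y'
  proof -
    have "lagrangian n s d A ell b r x z y' - B \<le> ?I"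
      using assms(1,2) le[OF _ _ that] by (intro cINF_greatest) (auto simp: algebra_simps)
    then show ?thesis by simp
  qed
  then have "(SUP y'\<in>Y. lagrangian n s d A ell b r x z y') \<le> ?I + B"
    using assms(3) by (intro cSUP_least) auto
  then show ?thesis by (simp add: gap_def)
qed

section \<open>Reduction of the block problem to a single variable, and the rate\<close>

theorem theorem1:
  "\<exists>C::real. 0 < C \<and>
    (\<forall>(n::nat) (s::nat) (d::nat \<Rightarrow> nat) (A::nat \<Rightarrow> real mat)
      (ell::real vec \<Rightarrow> real vec \<Rightarrow> real) (b::real vec) (r::nat \<Rightarrow> real vec \<Rightarrow> real)
      (L\<^sub>l::real) (L\<^sub>r::real) (X::real vec set) (Z::real vec set) (Y::real vec set) (\<gamma>::real)
      (K::nat) (x::nat \<Rightarrow> real vec) (z::nat \<Rightarrow> real vec) (y::nat \<Rightarrow> real vec)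
      (xh::nat \<Rightarrow> real vec) (zh::nat \<Rightarrow> real vec) (yh::nat \<Rightarrow> real vec).
      0 < n \<longrightarrow> 0 < s \<longrightarrow> (\<forall>i<n. 0 < d i) \<longrightarrow>
      (\<forall>i<n. A i \<in> carrier_mat s (d i)) \<longrightarrow>
      b \<in> carrier_vec s \<longrightarrow>
      smooth_vec s L\<^sub>l (\<lambda>w. ell w b) \<longrightarrow> convex_vec s (\<lambda>w. ell w b) \<longrightarrow>
      (\<forall>i<n. smooth_vec (d i) L\<^sub>r (r i) \<and> convex_vec (d i) (r i)) \<longrightarrow>
      X \<noteq> {} \<longrightarrow> compactin (euclid_topology (\<Sum>i<n. d i)) X \<longrightarrow>
      Z \<noteq> {} \<longrightarrow> compactin (euclid_topology s) Z \<longrightarrow>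
      Y \<noteq> {} \<longrightarrow> compactin (euclid_topology s) Y \<longrightarrow>
      ereal \<gamma> = 1 / 2 * Min {1,
        1 / ereal (sqrt (lambda_max (transpose_mat (hconcat n s A) * hconcat n s A))),
        1 / ereal L\<^sub>r, 1 / ereal L\<^sub>l} \<longrightarrow>
      1 \<le> K \<longrightarrow>
      egvfl n s d A ell b r \<gamma> K x z y xh zh yh \<longrightarrow>
      gap n s d A ell b r X Z Y
          (vmean (\<Sum>i<n. d i) K xh) (vmean s K zh) (vmean s K yh)
        \<le> C * ((1 + sqrt (lambda_max (transpose_mat (hconcat n s A) * hconcat n s A)) + L\<^sub>l + L\<^sub>r)
              * diam_sq X Z Y (x 0) (z 0) (y 0) / real K))"
proof (rule exI[of _ 1], intro conjI allI impI)
  show "0 < (1::real)" by simp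
next
  fix n s :: nat and d :: "nat \<Rightarrow> nat" and A :: "nat \<Rightarrow> real mat"
    and ell :: "real vec \<Rightarrow> real vec \<Rightarrow> real" and b :: "real vec" and r :: "nat \<Rightarrow> real vec \<Rightarrow> real"
    and Ll Lr :: real and X Z Y :: "real vec set" and \<gamma> :: real and K :: nat
    and x z y xh zh yh :: "nat \<Rightarrow> real vec"
  let ?D = "\<Sum>i<n. d i"
  let ?\<sigma> = "sqrt (lambda_max ((hconcat n s A)\<^sup>T * hconcat n s A))"
  assume n: "0 < n" and "0 < s" and dpos: "\<forall>i<n. 0 < d i"
    and A: "\<forall>i<n. A i \<in> carrier_mat s (d i)" and "b \<in> carrier_vec s"
    and ls: "smooth_vec s Ll (\<lambda>w. ell w b)" and lc: "convex_vec s (\<lambda>w. ell w b)"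
    and rs: "\<forall>i<n. smooth_vec (d i) Lr (r i) \<and> convex_vec (d i) (r i)"
    and X: "X \<noteq> {}" "compactin (euclid_topology ?D) X"
    and Z: "Z \<noteq> {}" "compactin (euclid_topology s) Z"
    and Y: "Y \<noteq> {}" "compactin (euclid_topology s) Y"
    and step: "ereal \<gamma> = 1 / 2 * Min {1, 1 / ereal ?\<sigma>, 1 / ereal Lr, 1 / ereal Ll}"
    and K: "1 \<le> K"
    and alg: "egvfl n s d A ell b r \<gamma> K x z y xh zh yh"
  define M where "M = hconcat n s A"
  define \<sigma> where "\<sigma> = ?\<sigma>"
  define gl where "gl = gradient s (\<lambda>w. ell w b)"
  define gR where "gR u = vconcat n (\<lambda>i. gradient (d i) (r i) (block d i u))" for u
  define R where "R u = (\<Sum>i<n. r i (block d i u))" for u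
  have M: "M \<in> carrier_mat s ?D" unfolding M_def using A by (intro hconcat_carrier) auto
  \<comment> \<open>The spectral lemmas ask for a positive dimension because they take a supremum
    over the unit sphere.\<close>
  have D: "0 < ?D" using block_index_less[of 0 n 0 d] n dpos by simp
  have Lpos: "0 < Lr" "0 < Ll" using rs n ls by (auto simp: smooth_vec_def)
  have \<sigma>: "0 \<le> \<sigma>" "\<sigma> = sqrt (lambda_max (M\<^sup>T * M))"
    using gram_le_lambda_max(1)[OF M D] by (auto simp: \<sigma>_def M_def)
  note step_bounds = stepsize_bounds[OF step[folded \<sigma>_def] \<sigma>(1) Lpos]
  have gri: "gradient (d i) (r i) (block d i u) \<in> carrier_vec (d i)" if "i < n" for i u
    using rs that by (intro gradient_carrier[of _ Lr]) auto
  have gR_carrier: "gR u \<in> carrier_vec ?D" for u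
    unfolding gR_def using gri by (rule vconcat_carrier)
  have block_gR: "block d i (gR u) = gradient (d i) (r i) (block d i u)" if "i < n" for i u
    unfolding gR_def using gri that by (rule block_vconcat)
  interpret extragradient s ?D M "\<lambda>w. ell w b" R gl gR Ll Lr \<sigma> \<gamma>
  proof
    show "M \<in> carrier_mat s ?D" by (rule M)
    show "gl u \<in> carrier_vec s" if "u \<in> carrier_vec s" for u
      unfolding gl_def using ls that by (rule gradient_carrier)
    show "gR u \<in> carrier_vec ?D" for u by (rule gR_carrier)
    show "ell u b + gl u \<bullet> (v - u) \<le> ell v b" if "u \<in> carrier_vec s" "v \<in> carrier_vec s" for u v
      using convex_vec_above_tangent[OF lc has_gradient_gradient[OF ls that(1)] that] by (simp add: gl_def)
    show "R u + gR u \<bullet> (v - u) \<le> R v" if uv: "u \<in> carrier_vec ?D" "v \<in> carrier_vec ?D" for u v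
    proof -
      have "R u + gR u \<bullet> (v - u) = (\<Sum>i<n. r i (block d i u) +
          gradient (d i) (r i) (block d i u) \<bullet> (block d i v - block d i u))"
        using uv by (simp add: R_def scalar_prod_blocks[of "v - u" d n] sum.distrib block_gR block_diff)
      also have "\<dots> \<le> R v" unfolding R_def
        using rs by (intro sum_mono convex_vec_above_tangent[OF _ has_gradient_gradient]) auto
      finally show ?thesis .
    qed
    show "vnorm (gl u - gl v) \<le> Ll * vnorm (u - v)" if "u \<in> carrier_vec s" "v \<in> carrier_vec s" for u v
      using ls that by (simp add: gl_def smooth_vec_def)
    show "vnorm (gR u - gR v) \<le> Lr * vnorm (u - v)" if uv: "u \<in> carrier_vec ?D" "v \<in> carrier_vec ?D" for u v
    proof -
      \<comment> \<open>Squared norms add up over blocks, so the assembled gradient keeps the common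
        constant \<open>Lr\<close>, with no factor depending on \<open>n\<close>.\<close>
      have "(gR u - gR v) \<bullet> (gR u - gR v)
          = (\<Sum>i<n. block d i (gR u - gR v) \<bullet> block d i (gR u - gR v))"
        using gR_carrier by (intro scalar_prod_blocks) auto
      also have "\<dots> \<le> (\<Sum>i<n. Lr\<^sup>2 * (block d i (u - v) \<bullet> block d i (u - v)))"
      proof (rule sum_mono)
        fix i assume "i \<in> {..<n}"
        then have i: "i < n" by simp
        have "vnorm (gradient (d i) (r i) (block d i u) - gradient (d i) (r i) (block d i v))
            \<le> Lr * vnorm (block d i u - block d i v)"
          using rs i by (simp add: smooth_vec_def)
        then have "vnorm (block d i (gR u - gR v)) \<le> Lr * vnorm (block d i (u - v))"
          using i uv gR_carrier by (simp add: block_diff block_gR)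
        then show "block d i (gR u - gR v) \<bullet> block d i (gR u - gR v)
            \<le> Lr\<^sup>2 * (block d i (u - v) \<bullet> block d i (u - v))"
          using Lpos(1) by (simp add: vnorm_le_iff)
      qed
      also have "\<dots> = Lr\<^sup>2 * ((u - v) \<bullet> (u - v))"
        using uv by (simp add: scalar_prod_blocks[of "u - v" d n] sum_distrib_left)
      finally show ?thesis using Lpos(1) by (simp add: vnorm_le_iff)
    qed
    show "vnorm (M *\<^sub>v v) \<le> \<sigma> * vnorm v" if "v \<in> carrier_vec ?D" for v
      unfolding \<sigma>(2) using M D that by (rule vnorm_mult_mat_le)
    show "vnorm (M\<^sup>T *\<^sub>v w) \<le> \<sigma> * vnorm w" if "w \<in> carrier_vec s" for w
      unfolding \<sigma>(2) using M D that by (rule vnorm_mult_transpose_mat_le)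
  qed (use step_bounds in auto)
  have Mv: "vsum s (\<lambda>i. A i *\<^sub>v block d i u) n = M *\<^sub>v u" if "u \<in> carrier_vec ?D" for u
    unfolding M_def using A that by (intro hconcat_mult_vec[symmetric]) auto
  have lag: "lagrangian n s d A ell b r u v w = lag u v w" if "u \<in> carrier_vec ?D" for u v w
    by (simp add: lagrangian_def lag_def R_def Mv[OF that])
  have c: "x k \<in> carrier_vec ?D" "z k \<in> carrier_vec s" "y k \<in> carrier_vec s" if "k \<le> K" for k
    using alg that by (auto simp: egvfl_def)
  have ch: "xh k \<in> carrier_vec ?D" "zh k \<in> carrier_vec s" "yh k \<in> carrier_vec s" if "k < K" for k
    using alg that by (auto simp: egvfl_def)
  \<comment> \<open>Stated for separate points \<open>v\<close>, \<open>w\<close>, \<open>v'\<close>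
    to cover both updates: in the half step the gradient is taken at the base point \<open>v\<close>
    itself, in the full step \<open>w\<close> and \<open>v'\<close> are half-step iterates.\<close>
  have x_update: "u = v - \<gamma> \<cdot>\<^sub>v (M\<^sup>T *\<^sub>v w + gR v')"
    if uv: "u \<in> carrier_vec ?D" "v \<in> carrier_vec ?D" "w \<in> carrier_vec s"
      and eq: "\<And>i. i < n \<Longrightarrow> block d i u =
        block d i v - \<gamma> \<cdot>\<^sub>v ((A i)\<^sup>T *\<^sub>v w + gradient (d i) (r i) (block d i v'))" for u v v' w
  proof (rule block_eqI[of _ d n])
    show "v - \<gamma> \<cdot>\<^sub>v (M\<^sup>T *\<^sub>v w + gR v') \<in> carrier_vec ?D"
      using uv gR_carrier[of v'] MT_carrier[of w] by simp
    fix i assume i: "i < n"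
    have "block d i (M\<^sup>T *\<^sub>v w) = (A i)\<^sup>T *\<^sub>v w"
      unfolding M_def using A uv i by (intro block_hconcat_transpose_mult_vec) auto
    then show "block d i u = block d i (v - \<gamma> \<cdot>\<^sub>v (M\<^sup>T *\<^sub>v w + gR v'))"
      using i uv gR_carrier[of v'] MT_carrier[of w]
      by (simp add: eq block_diff[of i n] block_smult[of i n] block_add[of i n] block_gR)
  qed (rule uv)
  have main: "lag (vmean ?D K xh) (vmean s K zh) y' - lag x' z' (vmean s K yh)
      \<le> (1 + \<sigma> + Ll + Lr) * diam_sq X Z Y (x 0) (z 0) (y 0) / real K"
    if i: "x' \<in> X" "z' \<in> Z" "y' \<in> Y" and c': "x' \<in> carrier_vec ?D" "z' \<in> carrier_vec s" "y' \<in> carrier_vec s"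
    for x' z' y'
  proof -
    let ?d = "lag (vmean ?D K xh) (vmean s K zh) y' - lag x' z' (vmean s K yh)"
    let ?S = "diam_sq X Z Y (x 0) (z 0) (y 0)"
    have "2 * \<gamma> * real K * ?d \<le> (vnorm (x 0 - x'))\<^sup>2 + (vnorm (z 0 - z'))\<^sup>2 + (vnorm (y 0 - y'))\<^sup>2"
    proof (rule lag_vmean_diff_le)
      fix k assume k: "k < K"
      note ck = c[OF less_imp_le[OF k]] c[of "Suc k"] ch[OF k]
      show "xh k = x k - \<gamma> \<cdot>\<^sub>v (M\<^sup>T *\<^sub>v y k + gR (x k))"
        using alg k ck by (intro x_update) (auto simp: egvfl_def)
      show "x (Suc k) = x k - \<gamma> \<cdot>\<^sub>v (M\<^sup>T *\<^sub>v yh k + gR (xh k))"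
        using alg k ck by (intro x_update) (auto simp: egvfl_def)
      show "zh k = z k - \<gamma> \<cdot>\<^sub>v (gl (z k) - y k)" "z (Suc k) = z k - \<gamma> \<cdot>\<^sub>v (gl (zh k) - yh k)"
        using alg k by (auto simp: egvfl_def gl_def)
      show "yh k = y k + \<gamma> \<cdot>\<^sub>v (M *\<^sub>v x k - z k)" "y (Suc k) = y k + \<gamma> \<cdot>\<^sub>v (M *\<^sub>v xh k - zh k)"
        using alg k by (auto simp: egvfl_def Mv[OF ck(1)] Mv[OF ch(1)[OF k]])
    qed (use K c ch c' in auto)
    also have S: "\<dots> \<le> ?S"
      using X(2) Z(2) Y(2) c[of 0] i by (intro le_diam_sq) auto
    \<comment> \<open>Here the lower bound on the step size enters; multiplying by it preserves the
      inequality because the squared diameter is nonnegative. The factor \<open>2 * \<gamma>\<close>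
      then cancels on both sides.\<close>
    also have "?S \<le> (2 * \<gamma> * (1 + \<sigma> + Ll + Lr)) * ?S"
    proof -
      have "0 \<le> ?S" by (rule order_trans[OF _ S]) simp
      from mult_right_mono[OF step_bounds(6) this] show ?thesis by simp
    qed
    finally have "2 * \<gamma> * (real K * ?d) \<le> 2 * \<gamma> * ((1 + \<sigma> + Ll + Lr) * ?S)"
      by (simp only: mult.assoc)
    then have "real K * ?d \<le> (1 + \<sigma> + Ll + Lr) * ?S"
      by (rule mult_left_le_imp_le) (use step_bounds(1) in simp)
    then show ?thesis using K by (simp add: le_divide_eq mult.commute)
  qed
  have sub: "X \<subseteq> carrier_vec ?D" "Z \<subseteq> carrier_vec s" "Y \<subseteq> carrier_vec s"
    using X(2) Z(2) Y(2) c[of 0] compactin_euclid_topology_bounded by blast+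
  have "gap n s d A ell b r X Z Y (vmean ?D K xh) (vmean s K zh) (vmean s K yh)
    \<le> (1 + \<sigma> + Ll + Lr) * diam_sq X Z Y (x 0) (z 0) (y 0) / real K"
  proof (rule gap_le[OF X(1) Z(1) Y(1)])
    fix x' z' y' assume i: "x' \<in> X" "z' \<in> Z" "y' \<in> Y"
    then have c': "x' \<in> carrier_vec ?D" "z' \<in> carrier_vec s" "y' \<in> carrier_vec s" using sub by auto
    show "lagrangian n s d A ell b r (vmean ?D K xh) (vmean s K zh) y'
        - lagrangian n s d A ell b r x' z' (vmean s K yh)
        \<le> (1 + \<sigma> + Ll + Lr) * diam_sq X Z Y (x 0) (z 0) (y 0) / real K"
      using main[OF i c'] lag[OF c'(1)] lag[OF vmean_carrier[OF ch(1)]] by simp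
  qed
  then show "gap n s d A ell b r X Z Y (vmean ?D K xh) (vmean s K zh) (vmean s K yh)
    \<le> 1 * ((1 + ?\<sigma> + Ll + Lr) * diam_sq X Z Y (x 0) (z 0) (y 0) / real K)"
    by (simp add: \<sigma>_def)
qed

end
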